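(* Let $s$ be an odd positive integer, $k$ a positive integer, $n\ge0$ an integer, and $\lambda$ a strict partition of $n+sk$. Then $$T^{(s)-}_kQ_\lambda.1=\sum_{\mu}\operatorname{Pf}(\tilde M(\lambda/\mu))\,Q_\mu.1,$$ where the sum runs over all strict partitions $\mu$ of $n$ such that $\mu\subset\lambda$.
   Context: A strict partition has distinct positive parts; $l(\cdot)$ is the number of positive parts; $\mu\subset\lambda$ means $\mu_i\le\lambda_i$ for all $i$. Let $\Gamma_{\mathbb Q}=\mathbb Q[p_1,p_3,p_5,\dots]$. Define operators $Q_m$ ($m\in\mathbb Z$) on $\Gamma_{\mathbb Q}$ by $$Q(z)=\exp\Big(\sum_{m\ge1\text{ odd}}\tfrac2m p_mz^m\Big)\exp\Big(-\sum_{m\ge1\text{ odd}}\tfrac{\partial}{\partial p_m}z^{-m}\Big)=\sum_{m\in\mathbb Z}Q_mz^m ,$$ and for $\lambda=(\lambda_1,\dots,\lambda_l)$ put $Q_\lambda.1=Q_{\lambda_1}\cdots Q_{\lambda_l}.1$ (this is the Schur $Q$-function $Q_\lambda$ for $\lambda$ strict). The operators $T^{(s)-}_m$ on $\Gamma_{\mathbb Q}$ are defined by $\exp\big(\sum_{m\ge1\text{ odd}}s\frac{\partial}{\partial p_{sm}}z^{-m}\big)=\sum_{m\ge0}T^{(s)-}_mz^{-m}$. The numbers $f$: for $j\in\mathbb Z$, $f_j=1$ if $j=0$, $f_j=2$ if $j>0$ and $s\mid j$, and $f_j=0$ otherwise. For $m,n\ge0$, $f_{(m,n)}=f_mf_n+2\sum_{j=1}^n(-1)^jf_{m+j}f_{n-j}$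 if $n\ge1$, and $f_{(m,0)}=f_m$. The matrix: write $\lambda=(\lambda_1,\dots,\lambda_b)$ with $b=l(\lambda)$ and $\mu=(\mu_1,\dots,\mu_a)$ with $a=l(\mu)$ if $l(\lambda)+l(\mu)$ is even, and $a=l(\mu)+1$, $\mu_a=0$ if $l(\lambda)+l(\mu)$ is odd, so that $a+b$ is even. Then $\tilde M(\lambda/\mu)$ is the antisymmetric $(a+b)\times(a+b)$ block matrix $\begin{pmatrix}0&X\\-X^T&Y\end{pmatrix}$ with zero $a\times a$ block, $X_{ij}=f_{\lambda_j-\mu_{a-i+1}}$ ($1\le i\le a$, $1\le j\le b$), and $Y$ the antisymmetric $b\times b$ matrix with $Y_{ij}=f_{(\lambda_i,\lambda_j)}$ for $1\le i<j\le b$. $\operatorname{Pf}$ denotes the Pfaffian (normalized so that $\operatorname{Pf}\begin{pmatrix}0&x\\-x&0\end{pmatrix}=x$; the Pfaffian of the empty matrix is $1$). *)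

theory Defs
  imports
    "HOL-Library.Poly_Mapping"
    "HOL-Combinatorics.Permutations"
    "Jordan_Normal_Form.Matrix"
begin

section \<open>The polynomial ring in the odd power sums\<close>

text \<open>
  The ring \<open>\<rat>[p\<^sub>1, p\<^sub>3, p\<^sub>5, \<dots>]\<close>: a monomial is a finitely supported exponent function, and the
  exponent at \<open>i\<close> is that of the variable \<open>p\<^bsub>2i+1\<^esub>\<close>.  For odd \<open>m\<close> the variable \<open>p\<^sub>m\<close> thus has
  index \<open>m div 2\<close>.
\<close>

type_synonym Gamma = "(nat \<Rightarrow>\<^sub>0 nat) \<Rightarrow>\<^sub>0 rat"

definition scal :: "rat \<Rightarrow> Gamma \<Rightarrow> Gamma" where
  "scal c F = Poly_Mapping.single 0 c * F"

text \<open>\<open>pvar m\<close> and \<open>pderiv_p m\<close> are \<open>p\<^sub>m\<close> and \<open>\<partial>/\<partial>p\<^sub>m\<close>; they are used for odd \<open>m\<close> only.\<close>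

definition pvar :: "nat \<Rightarrow> Gamma" where
  "pvar m = Poly_Mapping.single (Poly_Mapping.single (m div 2) 1) 1"

text \<open>
  The truncated subtraction of exponents is harmless: if the variable does not occur in \<open>t\<close>, the
  new coefficient is 0.
\<close>

definition pderiv_p :: "nat \<Rightarrow> Gamma \<Rightarrow> Gamma" where
  "pderiv_p m F = (\<Sum>t \<in> Poly_Mapping.keys F.
     Poly_Mapping.single (t - Poly_Mapping.single (m div 2) 1)
       (of_nat (Poly_Mapping.lookup t (m div 2)) * Poly_Mapping.lookup F t))"

section \<open>Formal power series of operators\<close>

text \<open>
  \<open>A :: op_series\<close> stands for \<open>\<Sum>n. A n u\<^sup>n\<close>, where \<open>u\<close> is a formal variable (instantiated to \<open>z\<close> or
  to \<open>z\<^sup>-\<^sup>1\<close>) and the coefficients are operators on the polynomial ring, multiplied by composition.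
\<close>

type_synonym op_series = "nat \<Rightarrow> Gamma \<Rightarrow> Gamma"

definition series_one :: op_series where
  "series_one n F = (if n = 0 then F else 0)"

definition series_mult :: "op_series \<Rightarrow> op_series \<Rightarrow> op_series" where
  "series_mult A B n F = (\<Sum>i\<le>n. A i (B (n - i) F))"

definition series_power :: "op_series \<Rightarrow> nat \<Rightarrow> op_series" where
  "series_power A r = (series_mult A ^^ r) series_one"

text \<open>
  The exponential of a series without constant term: then \<open>A\<^sup>r\<close> does not contribute to the
  coefficient of \<open>u\<^sup>n\<close> when \<open>r > n\<close>, so that \<open>\<Sum>r. A\<^sup>r / r!\<close> may be cut off at \<open>r = n\<close>.
\<close>

definition series_exp :: "op_series \<Rightarrow> op_series" where
  "series_exp A n F = (\<Sum>r\<le>n. scal (1 / fact r) (series_power A r n F))"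

section \<open>The operators\<close>

text \<open>
  \<open>Q_creat i\<close> is the coefficient of \<open>z\<^sup>i\<close> in the first exponential factor of \<open>Q(z)\<close>, \<open>Q_annih j\<close> the
  coefficient of \<open>z\<^bsup>-j\<^esup>\<close> in the second one.
\<close>

definition Q_creat :: op_series where
  "Q_creat = series_exp (\<lambda>m F. if odd m then scal (2 / of_nat m) (pvar m * F) else 0)"

definition Q_annih :: op_series where
  "Q_annih = series_exp (\<lambda>m F. if odd m then - pderiv_p m F else 0)"

text \<open>
  The coefficient of \<open>z\<^sup>m\<close> in \<open>Q(z)\<close> is the sum of \<open>Q_creat i \<circ> Q_annih j\<close> over all \<open>i, j \<ge> 0\<close> with
  \<open>i - j = m\<close>.  Applied to a fixed \<open>F\<close>, only finitely many of these terms are nonzero; see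
  \<open>finite_Q_op_support\<close> below.
\<close>

definition Q_op :: "int \<Rightarrow> Gamma \<Rightarrow> Gamma" where
  "Q_op m F = Sum_any (\<lambda>j::nat.
     if m + int j \<ge> 0 then Q_creat (nat (m + int j)) (Q_annih j F) else 0)"

definition Q_dot_1 :: "nat list \<Rightarrow> Gamma" where
  "Q_dot_1 lam = foldr (\<lambda>m F. Q_op (int m) F) lam 1"

definition T_minus :: "nat \<Rightarrow> nat \<Rightarrow> Gamma \<Rightarrow> Gamma" where
  "T_minus s = series_exp (\<lambda>m F. if odd m then scal (of_nat s) (pderiv_p (s * m) F) else 0)"

section \<open>Strict partitions\<close>

text \<open>A strict partition is the list of its (positive) parts; the missing parts count as 0.\<close>

definition strict_partition :: "nat list \<Rightarrow> bool" where
  "strict_partition lam \<longleftrightarrow> sorted_wrt (>) lam \<and> (\<forall>x \<in> set lam. x > 0)"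

definition part :: "nat list \<Rightarrow> nat \<Rightarrow> nat" where
  "part lam i = (if i < length lam then lam ! i else 0)"

definition part_contained :: "nat list \<Rightarrow> nat list \<Rightarrow> bool" where
  "part_contained mu lam \<longleftrightarrow> (\<forall>i. part mu i \<le> part lam i)"

section \<open>The matrix and its Pfaffian\<close>

definition f1 :: "nat \<Rightarrow> int \<Rightarrow> rat" where
  "f1 s j = (if j = 0 then 1 else if j > 0 \<and> int s dvd j then 2 else 0)"

definition f2 :: "nat \<Rightarrow> nat \<Rightarrow> nat \<Rightarrow> rat" where
  "f2 s m n = (if n = 0 then f1 s (int m)
     else f1 s (int m) * f1 s (int n)
       + 2 * (\<Sum>j = 1..n. (-1) ^ j * f1 s (int m + int j) * f1 s (int n - int j)))"

definition M_rows :: "nat list \<Rightarrow> nat list \<Rightarrow> nat" where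
  "M_rows lam mu = (if even (length lam + length mu) then length mu else length mu + 1)"

text \<open>
  Rows, columns and parts are counted from 0.  With \<open>a = M_rows lam mu\<close>, the part
  \<open>\<mu>\<^bsub>a-i+1\<^esub>\<close> for \<open>1 \<le> i \<le> a\<close> becomes \<open>part mu (a - 1 - i)\<close> for \<open>i < a\<close>.
\<close>

definition M_X :: "nat \<Rightarrow> nat list \<Rightarrow> nat list \<Rightarrow> rat mat" where
  "M_X s lam mu = mat (M_rows lam mu) (length lam)
     (\<lambda>(i, j). f1 s (int (part lam j) - int (part mu (M_rows lam mu - 1 - i))))"

definition M_Y :: "nat \<Rightarrow> nat list \<Rightarrow> rat mat" where
  "M_Y s lam = mat (length lam) (length lam)
     (\<lambda>(i, j). if i < j then f2 s (part lam i) (part lam j)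
               else if j < i then - f2 s (part lam j) (part lam i) else 0)"

definition M_tilde :: "nat \<Rightarrow> nat list \<Rightarrow> nat list \<Rightarrow> rat mat" where
  "M_tilde s lam mu = four_block_mat
     (0\<^sub>m (M_rows lam mu) (M_rows lam mu)) (M_X s lam mu)
     (- transpose_mat (M_X s lam mu)) (M_Y s lam)"

text \<open>
  The Pfaffian of an antisymmetric matrix of even size \<open>2h\<close>:
  \<open>1 / (2\<^sup>h h!) \<Sum>\<sigma>. sgn(\<sigma>) \<Prod>i. A(\<sigma>(2i-1), \<sigma>(2i))\<close>, with indices counted from 0.
\<close>

definition pfaffian :: "rat mat \<Rightarrow> rat" where
  "pfaffian A = (\<Sum>\<sigma> | \<sigma> permutes {..<dim_row A}.
       of_int (sign \<sigma>) * (\<Prod>i < dim_row A div 2. A $$ (\<sigma> (2 * i), \<sigma> (2 * i + 1))))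
     / (2 ^ (dim_row A div 2) * fact (dim_row A div 2))"

section \<open>Finiteness of the sums\<close>

lemma finite_strict_partitions: "finite {mu. strict_partition mu \<and> sum_list mu = n \<and> P mu}"
proof -
  have "{mu. strict_partition mu \<and> sum_list mu = n \<and> P mu}
      \<subseteq> {mu. set mu \<subseteq> {..n} \<and> length mu \<le> n}"
  proof (rule subsetI)
    fix mu assume "mu \<in> {mu. strict_partition mu \<and> sum_list mu = n \<and> P mu}"
    then have pos: "\<forall>x \<in> set mu. x > 0" and sum: "sum_list mu = n"
      by (auto simp: strict_partition_def)
    have "(\<forall>x \<in> set xs. x > 0) \<Longrightarrow> length xs \<le> sum_list xs" for xs :: "nat list"
      by (induction xs) auto
    then show "mu \<in> {mu. set mu \<subseteq> {..n} \<and> length mu \<le> n}"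
      using pos sum member_le_sum_list by fastforce
  qed
  then show ?thesis
    using finite_lists_length_le[of "{..n}" n] finite_subset by blast
qed

definition weight :: "(nat \<Rightarrow>\<^sub>0 nat) \<Rightarrow> int" where
  "weight t = (\<Sum>i \<in> Poly_Mapping.keys t. int ((2 * i + 1) * Poly_Mapping.lookup t i))"

definition weight_le :: "int \<Rightarrow> Gamma \<Rightarrow> bool" where
  "weight_le d F \<longleftrightarrow> (\<forall>t \<in> Poly_Mapping.keys F. weight t \<le> d)"

lemma weight_nonneg: "weight t \<ge> 0"
  unfolding weight_def by (intro sum_nonneg) simp

lemma weight_superset:
  assumes "finite S" "Poly_Mapping.keys t \<subseteq> S"
  shows "weight t = (\<Sum>i\<in>S. int ((2 * i + 1) * Poly_Mapping.lookup t i))"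
  unfolding weight_def using assms
  by (intro sum.mono_neutral_left) (auto simp: in_keys_iff)

lemma weight_minus_single:
  assumes "odd m" "Poly_Mapping.lookup t (m div 2) > 0"
  shows "weight (t - Poly_Mapping.single (m div 2) 1) = weight t - int m"
proof -
  let ?i = "m div 2" and ?u = "t - Poly_Mapping.single (m div 2) 1"
  have i: "?i \<in> Poly_Mapping.keys t" using assms by (simp add: in_keys_iff)
  have sub: "Poly_Mapping.keys ?u \<subseteq> Poly_Mapping.keys t"
    by (auto simp: in_keys_iff lookup_minus)
  have "weight ?u = (\<Sum>j \<in> Poly_Mapping.keys t. int ((2 * j + 1) * Poly_Mapping.lookup t j)
      - (if j = ?i then int m else 0))"
    unfolding weight_superset[OF finite_keys sub]
  proof (rule sum.cong)
    fix j
    show "int ((2 * j + 1) * Poly_Mapping.lookup ?u j)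
        = int ((2 * j + 1) * Poly_Mapping.lookup t j) - (if j = ?i then int m else 0)"
    proof (cases "j = ?i")
      case True
      then obtain c where "Poly_Mapping.lookup t j = Suc c" using assms(2) gr0_implies_Suc by blast
      moreover have "2 * ?i + 1 = m" using assms(1) by simp
      ultimately show ?thesis using True
        by (simp add: lookup_minus lookup_single algebra_simps)
    qed (simp add: lookup_minus lookup_single)
  qed simp
  also have "\<dots> = weight t - int m"
    using i by (simp add: sum_subtractf weight_def)
  finally show ?thesis .
qed

lemma weight_le_0 [simp]: "weight_le d 0"
  by (simp add: weight_le_def)

lemma weight_le_sum: "(\<And>x. x \<in> S \<Longrightarrow> weight_le d (g x)) \<Longrightarrow> weight_le d (sum g S)"
proof (induction S rule: infinite_finite_induct)
  case (insert x S)
  have "Poly_Mapping.keys (g x + sum g S) \<subseteq> Poly_Mapping.keys (g x) \<union> Poly_Mapping.keys (sum g S)"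
    by (rule Poly_Mapping.keys_add)
  then show ?case using insert by (auto simp: weight_le_def)
qed simp_all

lemma weight_le_uminus: "weight_le d F \<Longrightarrow> weight_le d (- F)"
  by (simp add: weight_le_def)

lemma weight_le_scal: "weight_le d F \<Longrightarrow> weight_le d (scal c F)"
proof -
  have "Poly_Mapping.keys (scal c F) \<subseteq> {0 + b | b. b \<in> Poly_Mapping.keys F}"
    unfolding scal_def using Poly_Mapping.keys_mult[of "Poly_Mapping.single 0 c" F]
    by (auto split: if_splits)
  then show "weight_le d F \<Longrightarrow> weight_le d (scal c F)" by (auto simp: weight_le_def)
qed

lemma weight_le_pderiv_p:
  assumes "odd m" "weight_le d F"
  shows "weight_le (d - int m) (pderiv_p m F)"
  unfolding pderiv_p_def
proof (rule weight_le_sum)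
  fix t assume t: "t \<in> Poly_Mapping.keys F"
  show "weight_le (d - int m) (Poly_Mapping.single (t - Poly_Mapping.single (m div 2) 1)
       (of_nat (Poly_Mapping.lookup t (m div 2)) * Poly_Mapping.lookup F t))"
  proof (cases "Poly_Mapping.lookup t (m div 2) = 0")
    case False
    then show ?thesis
      using weight_minus_single[OF assms(1), of t] assms(2) t by (auto simp: weight_le_def)
  qed simp
qed

lemma weight_le_series_power:
  assumes A: "\<And>m d F. weight_le d F \<Longrightarrow> weight_le (d - int m) (A m F)"
    and F: "weight_le d F"
  shows "weight_le (d - int n) (series_power A r n F)"
proof (induction r arbitrary: n)
  case 0
  then show ?case using F by (simp add: series_power_def series_one_def)
next
  case (Suc r)
  have "weight_le (d - int n) (A i (series_power A r (n - i) F))" if "i \<le> n" for i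
    using A[OF Suc[of "n - i"], of i] that by (simp add: algebra_simps of_nat_diff)
  then show ?case by (auto simp: series_power_def series_mult_def intro!: weight_le_sum)
qed

lemma weight_le_Q_annih:
  assumes "weight_le d F"
  shows "weight_le (d - int n) (Q_annih n F)"
  unfolding Q_annih_def series_exp_def
  by (intro weight_le_sum weight_le_scal weight_le_series_power assms)
    (auto intro: weight_le_uminus weight_le_pderiv_p)

lemma Q_creat_0: "Q_creat n 0 = 0"
proof -
  have "series_power (\<lambda>m F. if odd m then scal (2 / of_nat m) (pvar m * F) else 0) r n 0 = 0"
    for r n
    by (induction r arbitrary: n)
      (simp_all add: series_power_def series_mult_def series_one_def scal_def cong: if_cong)
  then show ?thesis by (simp add: Q_creat_def series_exp_def scal_def)
qed

lemma finite_Q_op_support: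
  "finite {j. (if m + int j \<ge> 0 then Q_creat (nat (m + int j)) (Q_annih j F) else 0) \<noteq> 0}"
proof -
  define d where "d = (\<Sum>t \<in> Poly_Mapping.keys F. weight t)"
  have d: "weight_le d F"
    unfolding weight_le_def d_def by (auto intro: member_le_sum weight_nonneg)
  have "Q_annih j F = 0" if "j > nat d" for j
  proof -
    have "weight t < 0" if "t \<in> Poly_Mapping.keys (Q_annih j F)" for t
      using weight_le_Q_annih[OF d, of j] that \<open>j > nat d\<close> by (fastforce simp: weight_le_def)
    then show ?thesis using weight_nonneg by (metis ex_in_conv keys_eq_empty not_less)
  qed
  then have "{j. (if m + int j \<ge> 0 then Q_creat (nat (m + int j)) (Q_annih j F) else 0) \<noteq> 0}
      \<subseteq> {..nat d}"
    using Q_creat_0 by (auto simp: not_less[symmetric])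
  then show ?thesis using finite_subset by blast
qed

end

theory Submission
  imports Defs "Jordan_Normal_Form.Determinant"
begin

text \<open>
  Put \<open>Q(w) = \<Sum>m. Q\<^sub>m w\<^sup>m\<close> and \<open>T(u) = \<Sum>k. T\<^sub>k u\<^sup>k\<close>.  The theorem is an instance of Wick's theorem for
  the fermions \<open>Q\<^sub>m\<close>; the proof evaluates both sides by the same recursion on the parts of \<open>\<lambda>\<close>.

  \<^emph>\<open>Passing T through Q.\<close>  \<open>T(u)\<close> is the exponential of a derivation, hence multiplicative, and it
  multiplies the generating function of the one-row functions by a scalar series.  Therefore
  \<open>T(u) Q(w) = (1 + w\<^sup>s u) / (1 - w\<^sup>s u) Q(w) T(u)\<close> (lemma \<open>T_Q_op\<close>).  The coefficients of
  \<open>(1 + x\<^sup>s) / (1 - x\<^sup>s)\<close> are the numbers \<open>f\<close>.  Since \<open>T(u)\<close> fixes 1, the value \<open>T\<^sub>k Q\<^sub>\<lambda>.1\<close> is the part of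
  weight \<open>|\<lambda>| - sk\<close> of \<open>\<Psi>\<^sub>\<lambda>\<^sub>1 \<Psi>\<^sub>\<lambda>\<^sub>2 \<dots>.1\<close>, where \<open>\<Psi>\<^sub>m = \<Sum>i. f\<^bsub>m-i\<^esub> Q\<^sub>i\<close>.

  \<^emph>\<open>Straightening.\<close>  The operators satisfy \<open>Q\<^sub>m Q\<^sub>n + Q\<^sub>n Q\<^sub>m = 2 (-1)\<^sup>m \<delta>\<^bsub>m+n,0\<^esub>\<close> (lemma \<open>Q_op_anticommute\<close>)
  and \<open>Q\<^sub>m.1 = 0\<close> for \<open>m < 0\<close>.  So, up to sign and the factor 2, \<open>Q\<^sub>i\<close> for \<open>i > 0\<close> adds the part \<open>i\<close> to \<open>Q\<^sub>\<mu>.1\<close>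
  (or gives 0 if \<open>i\<close> is a part of \<open>\<mu>\<close>), \<open>Q\<^bsub>-i\<^esub>\<close> removes it (or gives 0 if it is not), and \<open>Q\<^sub>0\<close> changes only
  the sign.  Applying \<open>\<Psi>\<^sub>l\<close> to a combination of the \<open>Q\<^sub>\<mu>.1\<close> thus
  gives a three-term recursion for the coefficients (lemma \<open>straighten\<close>).

  \<^emph>\<open>Pfaffians.\<close>  The Pfaffian of the matrix obeys the same recursion, by expansion along the row of
  the new part \<open>l\<close> (lemmas \<open>padded_pf_expand\<close>, \<open>word_coeff_Cons\<close>).  The entries \<open>f\<^bsub>l-\<mu>\<^sub>i\<^esub>\<close> account for the
  parts added.  The entry \<open>f\<^bsub>(l,\<lambda>\<^sub>c)\<^esub>\<close> equals \<open>f\<^sub>l f\<^bsub>\<lambda>\<^sub>c\<^esub> + \<Sum>j. 2 (-1)\<^sup>j f\<^bsub>l+j\<^esub> f\<^bsub>\<lambda>\<^sub>c-j\<^esub>\<close>, and each summand is what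
  remains when \<open>\<Psi>\<^sub>l\<close> removes a part \<open>j\<close>: expanding the larger Pfaffian along the row of \<open>j\<close> produces
  the factors \<open>f\<^bsub>\<lambda>\<^sub>c-j\<^esub>\<close>.  The row of a part 0 is needed because \<open>Q\<^sub>0\<close> neither kills nor creates; it is
  treated uniformly in both parities by \<open>Pf w + Pf (0 w)\<close>, in which the summand of odd size vanishes,
  and the superfluous terms cancel because a Pfaffian with two equal rows is zero.

  \<^emph>\<open>Containment.\<close>  A nonzero term of the Pfaffian matches every part of \<open>\<mu>\<close> with a part of \<open>\<lambda>\<close> that is at
  least as large; hence for each \<open>x > 0\<close> at most as many parts of \<open>\<mu>\<close> as of \<open>\<lambda>\<close> are \<open>\<ge> x\<close>, that is,
  \<open>\<mu> \<subset> \<lambda>\<close>.  The sum may therefore be taken over all strict partitions of \<open>n\<close>.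

  The identities between exponentials \<open>E = exp A\<close> rest on the recursion \<open>n E\<^sub>n = \<Sum>m. m A\<^sub>m E\<^bsub>n-m\<^esub>\<close> (lemma
  \<open>exp_euler\<close>), which expresses differentiation with respect to the formal variable.
\<close>

section \<open>Pfaffians of words\<close>

text \<open>
  The signed sum over all ways to pair \<open>x\<close> with one letter of the word and to apply \<open>\<Phi>\<close> to the
  remaining letters: the first-row expansion of a Pfaffian, with \<open>\<Phi>\<close> in place of the smaller Pfaffians.
\<close>

fun contract :: "('a \<Rightarrow> 'a \<Rightarrow> rat) \<Rightarrow> 'a \<Rightarrow> ('a list \<Rightarrow> rat) \<Rightarrow> 'a list \<Rightarrow> rat" where
  "contract A x \<Phi> [] = 0"
| "contract A x \<Phi> (y # ys) = A x y * \<Phi> ys - contract A x (\<lambda>zs. \<Phi> (y # zs)) ys"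

lemma contract_cong [fundef_cong]:
  assumes "xs = ys" "\<And>zs. Suc (length zs) = length ys \<Longrightarrow> \<Phi> zs = \<Psi> zs"
  shows "contract A x \<Phi> xs = contract A x \<Psi> ys"
  unfolding assms(1) using assms(2)
proof (induction ys arbitrary: \<Phi> \<Psi>)
  case (Cons y ys)
  have "contract A x (\<lambda>zs. \<Phi> (y # zs)) ys = contract A x (\<lambda>zs. \<Psi> (y # zs)) ys"
    by (rule Cons.IH) (simp add: Cons.prems)
  then show ?case by (simp add: Cons.prems)
qed simp

text \<open>
  The Pfaffian of the matrix with entries \<open>A x y\<close>, where \<open>x\<close> and \<open>y\<close> run through the letters of the word.
\<close>

fun pf :: "('a \<Rightarrow> 'a \<Rightarrow> rat) \<Rightarrow> 'a list \<Rightarrow> rat" where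
  "pf A [] = 1"
| "pf A (x # xs) = contract A x (pf A) xs"

lemma contract_add: "contract A x (\<lambda>zs. \<Phi> zs + \<Psi> zs) ys = contract A x \<Phi> ys + contract A x \<Psi> ys"
  by (induction ys arbitrary: \<Phi> \<Psi>) (simp_all add: algebra_simps)

lemma contract_mult: "contract A x (\<lambda>zs. c * \<Phi> zs) ys = c * contract A x \<Phi> ys"
  by (induction ys arbitrary: \<Phi>) (simp_all add: algebra_simps)

lemma contract_uminus: "contract A x (\<lambda>zs. - \<Phi> zs) ys = - contract A x \<Phi> ys"
  using contract_mult[of A x "-1"] by simp

lemma contract_diff: "contract A x (\<lambda>zs. \<Phi> zs - \<Psi> zs) ys = contract A x \<Phi> ys - contract A x \<Psi> ys"
  using contract_add[of A x \<Phi> "\<lambda>zs. - \<Psi> zs"] by (simp add: contract_uminus)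

lemma contract_append:
  "contract A x \<Phi> (us @ vs) =
    contract A x (\<lambda>zs. \<Phi> (zs @ vs)) us + (-1) ^ length us * contract A x (\<lambda>zs. \<Phi> (us @ zs)) vs"
  by (induction us arbitrary: \<Phi>) (simp_all add: algebra_simps)

lemma contract_conv_sum:
  "contract A x \<Phi> ys =
    (\<Sum>p<length ys. (-1) ^ p * A x (ys ! p) * \<Phi> (take p ys @ drop (Suc p) ys))"
  by (induction ys arbitrary: \<Phi>)
    (simp_all add: sum.lessThan_Suc_shift sum_negf [symmetric] del: sum.lessThan_Suc)

text \<open>
  Removing two letters in either order leaves the same word, but removing the earlier letter first
  shifts the position of the later one by 1.
\<close>

lemma contract_anticommute:
  "contract A x (contract A y \<Phi>) zs = - contract A y (contract A x \<Phi>) zs"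
proof (induction zs arbitrary: \<Phi>)
  case (Cons z zs)
  show ?case using Cons[of "\<lambda>us. \<Phi> (z # us)"]
    by (simp add: contract_diff contract_mult)
qed simp

lemma contract_nonzero:
  assumes "contract A x \<Phi> ys \<noteq> 0"
  shows "\<exists>us y vs. ys = us @ y # vs \<and> A x y \<noteq> 0 \<and> \<Phi> (us @ vs) \<noteq> 0"
proof -
  obtain p where p: "p < length ys" "A x (ys ! p) \<noteq> 0" "\<Phi> (take p ys @ drop (Suc p) ys) \<noteq> 0"
    using assms unfolding contract_conv_sum by (metis (no_types, lifting) lessThan_iff mult_zero_left
        mult_zero_right sum.neutral)
  then show ?thesis using id_take_nth_drop[OF p(1)] by blast
qed

locale antisymmetric =
  fixes A :: "'a \<Rightarrow> 'a \<Rightarrow> rat"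
  assumes antisym: "A x y = - A y x"
begin

text \<open>
  Away from the first two letters the exchange happens inside the smaller Pfaffians.  At the front it
  is the antisymmetry of \<open>A\<close> together with the anticommutation of contractions.
\<close>

lemma pf_swap: "pf A (us @ x # y # vs) = - pf A (us @ y # x # vs)"
proof (induction "length us + length vs" arbitrary: us vs rule: less_induct)
  case less
  show ?case
  proof (cases us)
    case Nil
    have "pf A (x # y # vs) = A x y * pf A vs - contract A x (contract A y (pf A)) vs" for x y
      by (simp cong: contract_cong)
    then show ?thesis using Nil antisym[of x y] contract_anticommute[of A x y "pf A" vs]
      by simp
  next
    case (Cons z us')
    have 1: "contract A z (\<lambda>zs. pf A (zs @ x # y # vs)) us'
        = - contract A z (\<lambda>zs. pf A (zs @ y # x # vs)) us'"
      unfolding contract_uminus[symmetric] using Cons by (intro contract_cong less) auto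
    have 2: "contract A z (\<lambda>zs. pf A (us' @ x # y # zs)) vs
        = - contract A z (\<lambda>zs. pf A (us' @ y # x # zs)) vs"
      unfolding contract_uminus[symmetric] using Cons by (intro contract_cong less) auto
    show ?thesis unfolding Cons using 1 2 by (simp add: contract_append algebra_simps)
  qed
qed

lemma pf_move: "pf A (us @ x # vs) = (-1) ^ length us * pf A (x # us @ vs)"
proof (induction us arbitrary: vs rule: rev_induct)
  case (snoc y us)
  show ?case using pf_swap[of us y x vs] snoc[of "y # vs"] by simp
qed simp

lemma pf_repeat: "pf A (us @ x # x # vs) = 0"
  using pf_swap[of us x x vs] by simp

end

section \<open>The Pfaffian as a sum over permutations\<close>

definition permuted :: "'a list \<Rightarrow> (nat \<Rightarrow> nat) \<Rightarrow> 'a list" where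
  "permuted xs \<sigma> = map (\<lambda>i. xs ! \<sigma> i) [0..<length xs]"

text \<open>
  Alternation of an arbitrary function of words is needed because peeling one letter off a product
  over consecutive pairs leaves a function that is no longer such a product.
\<close>

definition alternation :: "('a list \<Rightarrow> rat) \<Rightarrow> 'a list \<Rightarrow> rat" where
  "alternation g xs =
    (\<Sum>\<sigma> | \<sigma> permutes {0..<length xs}. of_int (sign \<sigma>) * g (permuted xs \<sigma>))"

lemma permuted_permutation_insert:
  assumes "length xs = Suc n" "p < Suc n" "\<tau> permutes {0..<n}"
  shows "permuted xs (permutation_insert 0 p \<tau>)
    = xs ! p # permuted (take p xs @ drop (Suc p) xs) \<tau>"
proof (rule nth_equalityI)
  fix i assume "i < length (permuted xs (permutation_insert 0 p \<tau>))"
  then have i: "i < Suc n" using assms by (simp add: permuted_def)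
  have "\<tau> (i - 1) < n" if "i > 0"
    using that i permutes_in_image[OF assms(3), of "i - 1"] by auto
  then show "permuted xs (permutation_insert 0 p \<tau>) ! i
      = (xs ! p # permuted (take p xs @ drop (Suc p) xs) \<tau>) ! i"
    using assms i
    by (cases i) (auto simp: permuted_def permutation_insert_expand nth_append simp del: upt_Suc)
qed (use assms in \<open>simp add: permuted_def\<close>)

text \<open>
  The permutations are sorted by the letter that they move to the front.  Removing that letter is
  deletion of a row and a column of the permutation matrix, which explains the sign \<open>(-1)\<^sup>p\<close>.
\<close>

lemma alternation_step:
  assumes "length xs = Suc n"
  shows "alternation g xs = (\<Sum>p<Suc n. (-1) ^ p *
    alternation (\<lambda>zs. g (xs ! p # zs)) (take p xs @ drop (Suc p) xs))"
proof -
  let ?h = "\<lambda>\<sigma>. of_int (sign \<sigma>) * g (permuted xs \<sigma>)"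
  have "alternation g xs = (\<Sum>\<sigma> | \<sigma> permutes {0..<Suc n}. ?h \<sigma>)"
    by (simp add: alternation_def assms)
  also have "\<dots> = (\<Sum>p<Suc n. \<Sum>\<sigma> | \<sigma> permutes {0..<Suc n} \<and> \<sigma> 0 = p. ?h \<sigma>)"
  proof -
    have "\<sigma> 0 < Suc n" if "\<sigma> permutes {0..<Suc n}" for \<sigma>
      using permutes_in_image[OF that, of 0] by simp
    then show ?thesis
      using sum.group[of "{\<sigma>. \<sigma> permutes {0..<Suc n}}" "{..<Suc n}" "\<lambda>\<sigma>. \<sigma> 0" ?h]
      by (simp add: image_subset_iff finite_permutations del: sum.lessThan_Suc)
  qed
  also have "\<dots> = (\<Sum>p<Suc n. (-1) ^ p *
    alternation (\<lambda>zs. g (xs ! p # zs)) (take p xs @ drop (Suc p) xs))"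
  proof (rule sum.cong)
    fix p assume "p \<in> {..<Suc n}"
    then have p: "p < Suc n" by simp
    let ?ys = "take p xs @ drop (Suc p) xs"
    have len: "length ?ys = n" using p assms by simp
    have "(\<Sum>\<sigma> | \<sigma> permutes {0..<Suc n} \<and> \<sigma> 0 = p. ?h \<sigma>)
        = (\<Sum>\<tau> | \<tau> permutes {0..<n}. ?h (permutation_insert 0 p \<tau>))"
      unfolding permutation_fix[of 0 n p, OF _ p, simplified]
      by (rule sum.reindex_cong[OF permutation_insert_inj_on]) (use p in auto)
    also have "\<dots> = (\<Sum>\<tau> | \<tau> permutes {0..<n}.
        (-1) ^ p * (of_int (sign \<tau>) * g (xs ! p # permuted ?ys \<tau>)))"
      using p assms
      by (intro sum.cong refl)
        (simp add: permuted_permutation_insert[OF assms] signof_permutation_insert)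
    finally show "(\<Sum>\<sigma> | \<sigma> permutes {0..<Suc n} \<and> \<sigma> 0 = p. ?h \<sigma>)
        = (-1) ^ p * alternation (\<lambda>zs. g (xs ! p # zs)) ?ys"
      by (simp only: alternation_def len sum_distrib_left)
  qed simp
  finally show ?thesis .
qed

fun consecutive :: "('a \<Rightarrow> 'a \<Rightarrow> rat) \<Rightarrow> 'a list \<Rightarrow> rat" where
  "consecutive A (x # y # zs) = A x y * consecutive A zs"
| "consecutive A _ = 1"

lemma consecutive_conv_prod:
  "consecutive A w = (\<Prod>i<length w div 2. A (w ! (2 * i)) (w ! (2 * i + 1)))"
  by (induction A w rule: consecutive.induct)
    (simp_all add: prod.lessThan_Suc_shift del: prod.lessThan_Suc)

lemma alternation_mult: "alternation (\<lambda>zs. c * g zs) xs = c * alternation g xs"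
  by (simp add: alternation_def sum_distrib_left mult_ac)

text \<open>
  Peeling off two letters and applying the induction hypothesis gives, for each first letter, the
  Pfaffian with that letter moved to the front, that is, up to the sign that is already present, the
  Pfaffian itself.  The \<open>2h + 2\<close> choices of the first letter supply the new factors of \<open>2\<^bsup>h+1\<^esup> (h+1)!\<close>.
\<close>

lemma (in antisymmetric) alternation_consecutive:
  "length xs = 2 * h \<Longrightarrow> alternation (consecutive A) xs = 2 ^ h * fact h * pf A xs"
proof (induction h arbitrary: xs)
  case 0
  then show ?case by (simp add: alternation_def permuted_def)
next
  case (Suc h)
  let ?del = "\<lambda>p xs. take p xs @ drop (Suc p) xs"
  have len: "length xs = Suc (Suc (2 * h))" using Suc.prems by simp
  have inner: "alternation (\<lambda>zs. consecutive A (x # zs)) ys = 2 ^ h * fact h * contract A x (pf A) ys"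
    if "length ys = Suc (2 * h)" for x ys
  proof -
    have "alternation (\<lambda>zs. consecutive A (x # zs)) ys
        = (\<Sum>q<length ys. (-1) ^ q * (A x (ys ! q) * alternation (consecutive A) (?del q ys)))"
      unfolding alternation_step[OF that] using that by (simp add: alternation_mult)
    also have "\<dots> = (\<Sum>q<length ys. 2 ^ h * fact h *
        ((-1) ^ q * A x (ys ! q) * pf A (?del q ys)))"
      using that by (intro sum.cong refl) (subst Suc.IH, auto)
    finally show ?thesis by (simp only: contract_conv_sum sum_distrib_left)
  qed
  have "alternation (consecutive A) xs
      = (\<Sum>p<length xs. (-1) ^ p * (2 ^ h * fact h * pf A (xs ! p # ?del p xs)))"
    unfolding alternation_step[OF len] using len by (intro sum.cong) (auto simp: inner)
  also have "\<dots> = (\<Sum>p<length xs. 2 ^ h * fact h * pf A xs)"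
  proof (intro sum.cong refl)
    fix p assume "p \<in> {..<length xs}"
    then have p: "p < length xs" by simp
    show "(-1) ^ p * (2 ^ h * fact h * pf A (xs ! p # ?del p xs)) = 2 ^ h * fact h * pf A xs"
      using pf_move[of "take p xs" "xs ! p" "drop (Suc p) xs"] p
      by (simp add: id_take_nth_drop[OF p, symmetric] del: pf.simps)
  qed
  also have "\<dots> = 2 ^ Suc h * fact (Suc h) * pf A xs"
    using len by (simp add: algebra_simps)
  finally show ?case .
qed

lemma (in antisymmetric) pfaffian_eq_pf:
  assumes "even (length xs)"
  shows "pfaffian (mat (length xs) (length xs) (\<lambda>(i, j). A (xs ! i) (xs ! j))) = pf A xs"
proof -
  obtain h where h: "length xs = 2 * h" using assms by blast
  have "(\<Prod>i<h. mat (2 * h) (2 * h) (\<lambda>(i, j). A (xs ! i) (xs ! j)) $$ (\<sigma> (2 * i), \<sigma> (2 * i + 1)))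
      = consecutive A (permuted xs \<sigma>)" if "\<sigma> permutes {0..<2 * h}" for \<sigma>
    unfolding consecutive_conv_prod
  proof (intro prod.cong)
    fix i assume "i \<in> {..<length (permuted xs \<sigma>) div 2}"
    then have "i < h" using h by (simp add: permuted_def)
    then show "mat (2 * h) (2 * h) (\<lambda>(i, j). A (xs ! i) (xs ! j)) $$ (\<sigma> (2 * i), \<sigma> (2 * i + 1))
      = A (permuted xs \<sigma> ! (2 * i)) (permuted xs \<sigma> ! (2 * i + 1))"
      using permutes_in_image[OF that, of "2 * i"] permutes_in_image[OF that, of "2 * i + 1"] h
      by (simp add: permuted_def)
  qed (simp add: permuted_def h)
  then have "pfaffian (mat (length xs) (length xs) (\<lambda>(i, j). A (xs ! i) (xs ! j)))
      = alternation (consecutive A) xs / (2 ^ h * fact h)"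
    by (simp add: pfaffian_def alternation_def h atLeast0LessThan)
  then show ?thesis using alternation_consecutive[OF h] by simp
qed

section \<open>Linear operators on the polynomial ring\<close>

interpretation scal: vector_space scal
  by unfold_locales
    (simp_all add: scal_def algebra_simps single_add mult_single mult.assoc [symmetric])

lemma scal_mult_left [simp]: "scal c F * G = scal c (F * G)"
  by (simp add: scal_def mult.assoc)

lemma scal_mult_right [simp]: "F * scal c G = scal c (F * G)"
  by (simp add: scal_def mult.left_commute)

abbreviation linop :: "(Gamma \<Rightarrow> Gamma) \<Rightarrow> bool" where
  "linop \<equiv> module_hom scal scal"

lemma linopI:
  assumes "\<And>F G. A (F + G) = A F + A G" "\<And>c F. A (scal c F) = scal c (A F)"
  shows "linop A"
  using assms by unfold_locales

lemmas linop_add = module_hom.add and linop_scal = module_hom.scale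
  and linop_sum = module_hom.sum and linop_zero = module_hom.zero

lemma linop_sumI: "(\<And>i. i \<in> I \<Longrightarrow> linop (A i)) \<Longrightarrow> linop (\<lambda>F. \<Sum>i\<in>I. A i F)"
  by (intro linopI)
    (auto simp: scal.scale_sum_right linop_add[of scal scal "A _"] linop_scal[of scal scal "A _"]
       simp flip: sum.distrib intro!: sum.cong)

lemma linop_scalI: "linop A \<Longrightarrow> linop (\<lambda>F. scal c (A F))"
  by (intro linopI) (simp_all add: linop_add linop_scal scal.scale_right_distrib mult.commute)

lemma linop_compI: "linop A \<Longrightarrow> linop B \<Longrightarrow> linop (\<lambda>F. A (B F))"
  by (intro linopI) (simp_all add: linop_add linop_scal)

lemma linop_mult: "linop (\<lambda>F. G * F)"
  by (intro linopI) (simp_all add: algebra_simps)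

lemma linop_const_zero: "linop (\<lambda>F. 0)"
  by (intro linopI) simp_all

lemma linop_ident: "linop (\<lambda>F. F)"
  by (intro linopI) simp_all

text \<open>
  The two reindexings that occur when the recursion for an exponential is inserted into a product of
  two series: this one for the right factor, the next one for the left factor.
\<close>

lemma triangle_swap:
  fixes f :: "nat \<Rightarrow> nat \<Rightarrow> 'a::comm_monoid_add"
  shows "(\<Sum>i\<le>n. \<Sum>m\<le>n - i. f i m) = (\<Sum>m\<le>n. \<Sum>i\<le>n - m. f i m)"
  unfolding sum.Sigma[OF finite_atMost, OF ballI, OF finite_atMost]
  by (rule sum.reindex_bij_witness[of _ "\<lambda>(i, m). (m, i)" "\<lambda>(i, m). (m, i)"]) auto

lemma triangle_shift:
  fixes f :: "nat \<Rightarrow> nat \<Rightarrow> 'a::comm_monoid_add"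
  shows "(\<Sum>i\<le>n. \<Sum>m\<le>i. f i m) = (\<Sum>m\<le>n. \<Sum>i\<le>n - m. f (i + m) m)"
  unfolding sum.Sigma[OF finite_atMost, OF ballI, OF finite_atMost]
  by (rule sum.reindex_bij_witness[of _ "\<lambda>(m, i). (i + m, m)" "\<lambda>(i, m). (m, i - m)"]) auto

lemma scal_of_nat_split:
  "i \<le> n \<Longrightarrow> scal (of_nat n) F = scal (of_nat i) F + scal (of_nat (n - i)) F"
  by (metis scal.scale_left_distrib of_nat_add le_add_diff_inverse)

section \<open>Exponentials of operator series\<close>

text \<open>
  The setting in which an exponential of operators behaves as a commutative one.  A vanishing
  constant term makes the truncated exponential an honest one.
\<close>

locale commuting_series =
  fixes A :: op_series
  assumes lin: "linop (A m)"
    and commute: "A m (A n F) = A n (A m F)"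
    and const_zero: "A 0 F = 0"
begin

lemma power_0: "series_power A 0 n F = (if n = 0 then F else 0)"
  by (simp add: series_power_def series_one_def)

lemma power_Suc: "series_power A (Suc r) n F = (\<Sum>i\<le>n. A i (series_power A r (n - i) F))"
  by (simp add: series_power_def series_mult_def)

lemma linop_power: "linop (series_power A r n)"
proof (induction r arbitrary: n)
  case 0
  then show ?case by (cases n) (auto simp: power_0[abs_def] linop_const_zero linop_ident)
next
  case (Suc r)
  then show ?case
    unfolding power_Suc[abs_def] by (intro linop_sumI linop_compI[OF lin Suc])
qed

lemma linop_exp: "linop (series_exp A n)"
  unfolding series_exp_def[abs_def] by (intro linop_sumI linop_scalI linop_power)

lemma exp_0: "series_exp A 0 F = F"
  by (simp add: series_exp_def power_0)

lemma power_commute: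
  assumes "linop B" "\<And>m F. B (A m F) = A m (B F)"
  shows "B (series_power A r n F) = series_power A r n (B F)"
proof (induction r arbitrary: n)
  case 0
  then show ?case by (simp add: power_0 linop_zero[OF assms(1)])
next
  case (Suc r)
  then show ?case by (simp add: power_Suc linop_sum[OF assms(1)] assms(2))
qed

lemma exp_commute:
  assumes "linop B" "\<And>m F. B (A m F) = A m (B F)"
  shows "B (series_exp A n F) = series_exp A n (B F)"
  by (simp add: series_exp_def linop_sum[OF assms(1)] linop_scal[OF assms(1)]
      power_commute[of B, OF assms])

lemma power_vanish: "n < r \<Longrightarrow> series_power A r n F = 0"
proof (induction r arbitrary: n)
  case (Suc r)
  have "A i (series_power A r (n - i) F) = 0" if "i \<le> n" for i
  proof (cases i)
    case 0
    then show ?thesis by (simp add: const_zero)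
  next
    case (Suc i')
    then show ?thesis using Suc.IH[of "n - i"] Suc.prems that linop_zero[OF lin] by simp
  qed
  then show ?case by (simp add: power_Suc)
qed simp

text \<open>
  The coefficient form of \<open>u d/du A\<^bsup>r+1\<^esup> = (r+1) (u d/du A) A\<^sup>r\<close>.
\<close>

lemma power_euler:
  "scal (of_nat n) (series_power A (Suc r) n F) =
    scal (of_nat (Suc r)) (\<Sum>m\<le>n. scal (of_nat m) (A m (series_power A r (n - m) F)))"
proof (induction r arbitrary: n)
  case 0
  have "scal (of_nat n) (A i (series_power A 0 (n - i) F))
      = scal (of_nat i) (A i (series_power A 0 (n - i) F))" if "i \<le> n" for i
    using that by (auto simp: power_0 linop_zero[OF lin])
  then have "scal (of_nat n) (\<Sum>i\<le>n. A i (series_power A 0 (n - i) F))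
      = (\<Sum>i\<le>n. scal (of_nat i) (A i (series_power A 0 (n - i) F)))"
    unfolding scal.scale_sum_right by (intro sum.cong) auto
  then show ?case by (simp add: power_Suc)
next
  case (Suc r)
  let ?P = "\<lambda>r n. series_power A r n F"
  let ?S = "\<Sum>m\<le>n. scal (of_nat m) (A m (?P (Suc r) (n - m)))"
  have "scal (of_nat n) (?P (Suc (Suc r)) n)
      = (\<Sum>i\<le>n. scal (of_nat i) (A i (?P (Suc r) (n - i)))
          + A i (scal (of_nat (n - i)) (?P (Suc r) (n - i))))"
    unfolding power_Suc[of "Suc r"] scal.scale_sum_right linop_scal[OF lin]
    by (intro sum.cong refl) (simp add: scal.scale_left_diff_distrib of_nat_diff)
  also have "\<dots> = ?S + (\<Sum>i\<le>n. A i (scal (of_nat (n - i)) (?P (Suc r) (n - i))))"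
    by (simp add: sum.distrib)
  also have "(\<Sum>i\<le>n. A i (scal (of_nat (n - i)) (?P (Suc r) (n - i))))
      = scal (of_nat (Suc r)) (\<Sum>i\<le>n. \<Sum>m\<le>n - i. scal (of_nat m) (A m (A i (?P r (n - i - m)))))"
    unfolding Suc linop_sum[OF lin] linop_scal[OF lin] scal.scale_sum_right
    by (simp add: commute)
  also have "(\<Sum>i\<le>n. \<Sum>m\<le>n - i. scal (of_nat m) (A m (A i (?P r (n - i - m))))) = ?S"
    by (subst triangle_swap)
      (simp add: power_Suc linop_sum[OF lin] scal.scale_sum_right add.commute)
  finally show ?case
    by (simp only: of_nat_Suc[of "Suc r"] scal.scale_left_distrib scal.scale_one)
qed

text \<open>
  The coefficient form of \<open>u d/du exp A = (u d/du A) exp A\<close>.  Together with \<open>exp_0\<close> it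
  determines the exponential.
\<close>

lemma exp_euler:
  "scal (of_nat n) (series_exp A n F) =
    (\<Sum>m\<le>n. scal (of_nat m) (A m (series_exp A (n - m) F)))"
proof (cases n)
  case 0
  then show ?thesis by (simp add: const_zero)
next
  case (Suc n')
  let ?P = "\<lambda>r n. series_power A r n F"
  have trunc: "series_exp A (n - m) F = (\<Sum>r\<le>n'. scal (1 / fact r) (?P r (n - m)))"
    if "m > 0" for m
    unfolding series_exp_def using that Suc
    by (intro sum.mono_neutral_left) (auto simp: power_vanish)
  have "scal (of_nat n) (series_exp A n F)
      = (\<Sum>r\<le>n. scal (1 / fact r) (scal (of_nat n) (?P r n)))"
    by (simp add: series_exp_def scal.scale_sum_right mult.commute)
  also have "\<dots> = (\<Sum>r\<le>n'. scal (1 / fact (Suc r)) (scal (of_nat n) (?P (Suc r) n)))"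
    using Suc by (simp add: sum.atMost_Suc_shift power_0 del: sum.atMost_Suc)
  also have "\<dots> = (\<Sum>r\<le>n'. scal (1 / fact r) (\<Sum>m\<le>n. scal (of_nat m) (A m (?P r (n - m)))))"
    unfolding power_euler by (simp add: divide_simps del: of_nat_Suc)
  also have "\<dots> = (\<Sum>m\<le>n. scal (of_nat m) (\<Sum>r\<le>n'. scal (1 / fact r) (A m (?P r (n - m)))))"
    unfolding scal.scale_sum_right by (subst sum.swap) (simp add: mult.commute)
  also have "\<dots> = (\<Sum>m\<le>n. scal (of_nat m) (A m (series_exp A (n - m) F)))"
  proof (intro sum.cong refl)
    fix m
    show "scal (of_nat m) (\<Sum>r\<le>n'. scal (1 / fact r) (A m (?P r (n - m))))
        = scal (of_nat m) (A m (series_exp A (n - m) F))"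
      by (cases "m = 0") (simp_all add: trunc linop_sum[OF lin] linop_scal[OF lin])
  qed
  finally show ?thesis .
qed

lemma exp_series_commute: "series_exp A m (series_exp A n F) = series_exp A n (series_exp A m F)"
  by (rule exp_commute[OF linop_exp], rule exp_commute[OF lin, symmetric], rule commute)

lemma A_exp_commute: "A m (series_exp A n F) = series_exp A n (A m F)"
  by (rule exp_commute[OF lin commute])

text \<open>
  If \<open>A\<close> is odd in \<open>u\<close>, then \<open>exp (A(u)) exp (A(-u)) = 1\<close>: by the recursion the logarithmic derivatives
  of the two factors cancel.
\<close>

lemma exp_reflect:
  assumes even: "\<And>m F. even m \<Longrightarrow> A m F = 0"
  shows "(\<Sum>i\<le>n. scal ((-1) ^ i) (series_exp A i (series_exp A (n - i) F))) = (if n = 0 then F else 0)"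
proof (cases "n = 0")
  case True
  then show ?thesis by (simp add: exp_0)
next
  case False
  let ?E = "series_exp A"
  have "scal (of_nat n) (\<Sum>i\<le>n. scal ((-1) ^ i) (?E i (?E (n - i) F)))
      = (\<Sum>i\<le>n. scal ((-1) ^ i) (scal (of_nat i) (?E i (?E (n - i) F))))
        + (\<Sum>i\<le>n. scal ((-1) ^ i) (?E i (scal (of_nat (n - i)) (?E (n - i) F))))"
    unfolding scal.scale_sum_right sum.distrib[symmetric] linop_scal[OF linop_exp]
  proof (intro sum.cong refl)
    fix i assume "i \<in> {..n}"
    then show "scal (of_nat n) (scal ((-1) ^ i) (?E i (?E (n - i) F)))
        = scal ((-1) ^ i) (scal (of_nat i) (?E i (?E (n - i) F)))
          + scal ((-1) ^ i) (scal (of_nat (n - i)) (?E i (?E (n - i) F)))"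
      unfolding scal.scale_right_distrib[symmetric]
      by (subst scal_of_nat_split[symmetric]) (simp_all add: mult.commute)
  qed
  also have "(\<Sum>i\<le>n. scal ((-1) ^ i) (scal (of_nat i) (?E i (?E (n - i) F))))
      = (\<Sum>m\<le>n. \<Sum>i\<le>n - m. scal ((-1) ^ (i + m)) (scal (of_nat m) (A m (?E i (?E (n - m - i) F)))))"
    unfolding exp_euler[of _ "?E _ F"] scal.scale_sum_right triangle_shift
    by (simp add: add.commute)
  also have "\<dots> = (\<Sum>m\<le>n. \<Sum>i\<le>n - m. - scal ((-1) ^ i) (scal (of_nat m) (A m (?E i (?E (n - m - i) F)))))"
  proof (intro sum.cong refl)
    fix m i
    show "scal ((-1) ^ (i + m)) (scal (of_nat m) (A m (?E i (?E (n - m - i) F))))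
        = - scal ((-1) ^ i) (scal (of_nat m) (A m (?E i (?E (n - m - i) F))))"
      by (cases "even m") (simp_all add: even power_add)
  qed
  also have "(\<Sum>i\<le>n. scal ((-1) ^ i) (?E i (scal (of_nat (n - i)) (?E (n - i) F))))
      = (\<Sum>m\<le>n. \<Sum>i\<le>n - m. scal ((-1) ^ i) (scal (of_nat m) (A m (?E i (?E (n - m - i) F)))))"
    unfolding exp_euler linop_sum[OF linop_exp] linop_scal[OF linop_exp] scal.scale_sum_right
      A_exp_commute[symmetric] by (subst triangle_swap) (simp add: add.commute)
  finally show ?thesis using False by (simp add: sum_negf)
qed

text \<open>
  In the recursion \<open>A\<^sub>m\<close> can be moved past the exponential to \<open>F\<close>; this is applied to \<open>F = 1\<close>.
\<close>

lemma exp_vacuum: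
  assumes "\<And>m. A m F = 0"
  shows "series_exp A n F = (if n = 0 then F else 0)"
proof (cases "n = 0")
  case False
  have "scal (of_nat n) (series_exp A n F) = 0"
    by (simp add: exp_euler A_exp_commute assms linop_zero[OF linop_exp])
  then show ?thesis using False by simp
qed (simp add: exp_0)

text \<open>
  The exponential of a derivation is multiplicative: both sides satisfy the recursion \<open>exp_euler\<close>.
\<close>

lemma exp_product:
  assumes leibniz: "\<And>m F G. A m (F * G) = A m F * G + F * A m G"
  shows "series_exp A n (F * G) = (\<Sum>i\<le>n. series_exp A i F * series_exp A (n - i) G)"
proof (induction n rule: less_induct)
  case (less n)
  let ?E = "series_exp A"
  show ?case
  proof (cases "n = 0")
    case True
    then show ?thesis by (simp add: exp_0)
  next
    case False
    have "scal (of_nat n) (?E n (F * G))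
        = (\<Sum>m\<le>n. scal (of_nat m) (A m (\<Sum>i\<le>n - m. ?E i F * ?E (n - m - i) G)))"
      unfolding exp_euler
    proof (intro sum.cong refl)
      fix m assume "m \<in> {..n}"
      then show "scal (of_nat m) (A m (?E (n - m) (F * G)))
          = scal (of_nat m) (A m (\<Sum>i\<le>n - m. ?E i F * ?E (n - m - i) G))"
        using False by (cases "m = 0") (simp_all add: less)
    qed
    also have "\<dots> = (\<Sum>m\<le>n. \<Sum>i\<le>n - m. scal (of_nat m) (A m (?E i F)) * ?E (n - m - i) G)
        + (\<Sum>m\<le>n. \<Sum>i\<le>n - m. ?E i F * scal (of_nat m) (A m (?E (n - m - i) G)))"
      by (simp add: linop_sum[OF lin] leibniz scal.scale_sum_right scal.scale_right_distrib sum.distrib)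
    also have "(\<Sum>m\<le>n. \<Sum>i\<le>n - m. scal (of_nat m) (A m (?E i F)) * ?E (n - m - i) G)
        = (\<Sum>i\<le>n. scal (of_nat i) (?E i F) * ?E (n - i) G)"
      unfolding exp_euler sum_distrib_right triangle_shift by (simp add: add.commute)
    also have "(\<Sum>m\<le>n. \<Sum>i\<le>n - m. ?E i F * scal (of_nat m) (A m (?E (n - m - i) G)))
        = (\<Sum>i\<le>n. ?E i F * scal (of_nat (n - i)) (?E (n - i) G))"
      unfolding exp_euler sum_distrib_left by (subst triangle_swap) (simp add: add.commute)
    also have "(\<Sum>i\<le>n. scal (of_nat i) (?E i F) * ?E (n - i) G)
        + (\<Sum>i\<le>n. ?E i F * scal (of_nat (n - i)) (?E (n - i) G))
        = scal (of_nat n) (\<Sum>i\<le>n. ?E i F * ?E (n - i) G)"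
      unfolding scal.scale_sum_right sum.distrib[symmetric]
    proof (intro sum.cong refl)
      fix i assume "i \<in> {..n}"
      then show "scal (of_nat i) (?E i F) * ?E (n - i) G + ?E i F * scal (of_nat (n - i)) (?E (n - i) G)
          = scal (of_nat n) (?E i F * ?E (n - i) G)"
        by (subst scal_of_nat_split[of i n]) simp_all
    qed
    finally show ?thesis using False by simp
  qed
qed

end


section \<open>Derivatives\<close>

lemma lookup_scal: "Poly_Mapping.lookup (scal c F) t = c * Poly_Mapping.lookup F t"
  unfolding scal_def mult_map_scale_conv_mult[symmetric] by (simp add: Poly_Mapping.map.rep_eq when_def)

lemma pderiv_p_superset:
  assumes "finite T" "Poly_Mapping.keys F \<subseteq> T"
  shows "pderiv_p m F = (\<Sum>t\<in>T. Poly_Mapping.single (t - Poly_Mapping.single (m div 2) 1)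
     (of_nat (Poly_Mapping.lookup t (m div 2)) * Poly_Mapping.lookup F t))"
  unfolding pderiv_p_def using assms
  by (intro sum.mono_neutral_left) (auto simp: in_keys_iff)

lemma linop_pderiv_p: "linop (pderiv_p m)"
proof (rule linopI)
  fix F G :: Gamma
  have "Poly_Mapping.keys (F + G) \<subseteq> Poly_Mapping.keys F \<union> Poly_Mapping.keys G" by (rule Poly_Mapping.keys_add)
  then show "pderiv_p m (F + G) = pderiv_p m F + pderiv_p m G"
    by (simp add: pderiv_p_superset[of "Poly_Mapping.keys F \<union> Poly_Mapping.keys G"] lookup_add distrib_left single_add
        sum.distrib)
next
  fix c and F :: Gamma
  have "Poly_Mapping.keys (scal c F) \<subseteq> Poly_Mapping.keys F" by (auto simp: in_keys_iff lookup_scal)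
  then show "pderiv_p m (scal c F) = scal c (pderiv_p m F)"
    by (simp add: pderiv_p_superset[of "Poly_Mapping.keys F"] lookup_scal scal.scale_sum_right)
      (simp add: scal_def mult_single mult.left_commute)
qed

lemma pderiv_p_single:
  "pderiv_p m (Poly_Mapping.single t c) =
    Poly_Mapping.single (t - Poly_Mapping.single (m div 2) 1) (of_nat (Poly_Mapping.lookup t (m div 2)) * c)"
  by (subst pderiv_p_superset[of "{t}"]) (auto split: if_splits)

text \<open>
  Additive identities need to be checked on monomials only.
\<close>

lemma poly_mapping_sum_induct:
  fixes F :: Gamma
  assumes "\<And>t c. P (Poly_Mapping.single t c)" "\<And>F G. P F \<Longrightarrow> P G \<Longrightarrow> P (F + G)"
  shows "P F"
proof -
  have "P (\<Sum>t\<in>T. Poly_Mapping.single t (Poly_Mapping.lookup F t))" if "finite T" for T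
    using that
  proof (induction T rule: finite_induct)
    case empty
    show ?case using assms(1)[of 0 0] by simp
  qed (simp add: assms)
  moreover have "F = (\<Sum>t\<in>Poly_Mapping.keys F. Poly_Mapping.single t (Poly_Mapping.lookup F t))"
    by (rule poly_mapping_eqI) (auto simp: lookup_sum lookup_single when_def in_keys_iff)
  ultimately show ?thesis using finite_keys by metis
qed

lemma pderiv_p_mult: "pderiv_p m (F * G) = pderiv_p m F * G + F * pderiv_p m G"
proof (induction F rule: poly_mapping_sum_induct)
  case (1 t c)
  show ?case
  proof (induction G rule: poly_mapping_sum_induct)
    case (1 u d)
    let ?e = "Poly_Mapping.single (m div 2) (1::nat)"
    \<comment> \<open>The exponents of the two products agree unless the variable is absent, and then the coefficient is 0.\<close>
    have move: "t - ?e + u = t + u - ?e" if "Poly_Mapping.lookup t (m div 2) \<noteq> 0" for t u :: "nat \<Rightarrow>\<^sub>0 nat"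
      using that by (intro poly_mapping_eqI) (auto simp: lookup_add lookup_minus lookup_single when_def)
    have "Poly_Mapping.single (t - ?e + u) (of_nat (Poly_Mapping.lookup t (m div 2)) * c * d)
        = Poly_Mapping.single (t + u - ?e) (of_nat (Poly_Mapping.lookup t (m div 2)) * c * d)"
      using move[of t u] by (cases "Poly_Mapping.lookup t (m div 2) = 0") simp_all
    moreover have "Poly_Mapping.single (t + (u - ?e)) (c * (of_nat (Poly_Mapping.lookup u (m div 2)) * d))
        = Poly_Mapping.single (t + u - ?e) (c * (of_nat (Poly_Mapping.lookup u (m div 2)) * d))"
      using move[of u t] by (cases "Poly_Mapping.lookup u (m div 2) = 0") (simp_all add: add.commute)
    ultimately show ?case
      by (simp add: pderiv_p_single mult_single lookup_add single_add[symmetric] algebra_simps)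
  qed (simp add: linop_add[OF linop_pderiv_p] algebra_simps)
qed (simp add: linop_add[OF linop_pderiv_p] algebra_simps)

lemma pderiv_p_commute: "pderiv_p m (pderiv_p n F) = pderiv_p n (pderiv_p m F)"
proof (induction F rule: poly_mapping_sum_induct)
  case (1 t c)
  have "t - u - v = t - v - u" for u v :: "nat \<Rightarrow>\<^sub>0 nat"
    by (rule poly_mapping_eqI) (simp add: lookup_minus)
  from this[of "Poly_Mapping.single (m div 2) 1" "Poly_Mapping.single (n div 2) 1"]
  show ?case
    by (cases "m div 2 = n div 2")
      (simp_all add: pderiv_p_single lookup_minus lookup_single mult_ac)
qed (simp add: linop_add[OF linop_pderiv_p])

lemma pderiv_p_pvar:
  assumes "odd m" "odd n"
  shows "pderiv_p m (pvar n) = (if m = n then 1 else 0)"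
proof -
  have "m div 2 \<noteq> n div 2" if "m \<noteq> n" using assms that by presburger
  then show ?thesis by (cases "m = n") (simp_all add: pvar_def pderiv_p_single lookup_single when_def)
qed

lemma pderiv_p_1: "pderiv_p m 1 = 0"
  using pderiv_p_single[of m 0 1] by simp

section \<open>The three exponentials\<close>

interpretation creat: commuting_series "\<lambda>m F. if odd m then scal (2 / of_nat m) (pvar m * F) else 0"
  by unfold_locales (auto simp: distrib_left scal.scale_right_distrib mult_ac)

interpretation annih: commuting_series "\<lambda>m F. if odd m then - pderiv_p m F else 0"
  by unfold_locales
    (auto simp: linop_zero[OF linop_pderiv_p] linop_add[OF linop_pderiv_p] linop_scal[OF linop_pderiv_p]
      module_hom.neg[OF linop_pderiv_p] pderiv_p_commute)

interpretation T: commuting_series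
  "\<lambda>m F. if odd m then scal (of_nat s) (pderiv_p (s * m) F) else 0" for s
  by unfold_locales
    (auto simp: linop_zero[OF linop_pderiv_p] linop_add[OF linop_pderiv_p] linop_scal[OF linop_pderiv_p]
      scal.scale_right_distrib pderiv_p_commute mult.commute)


lemma linop_annih: "linop (Q_annih n)"
  unfolding Q_annih_def by (rule annih.linop_exp)

lemma linop_T: "linop (T_minus s k)"
  unfolding T_minus_def by (rule T.linop_exp)

lemma T_annih_commute: "T_minus s k (Q_annih j F) = Q_annih j (T_minus s k F)"
  unfolding Q_annih_def
proof (rule annih.exp_commute[OF linop_T])
  fix m F
  show "T_minus s k (if odd m then - pderiv_p m F else 0)
      = (if odd m then - pderiv_p m (T_minus s k F) else 0)"
    unfolding T_minus_def
    by (auto simp: module_hom.neg[OF T.linop_exp] linop_zero[OF T.linop_exp]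
        linop_zero[OF linop_pderiv_p] linop_scal[OF linop_pderiv_p] pderiv_p_commute
        intro!: T.exp_commute[OF linop_pderiv_p, symmetric])
qed

lemma annih_product: "Q_annih n (F * G) = (\<Sum>i\<le>n. Q_annih i F * Q_annih (n - i) G)"
  unfolding Q_annih_def by (rule annih.exp_product) (simp add: pderiv_p_mult)

lemma T_product: "T_minus s n (F * G) = (\<Sum>i\<le>n. T_minus s i F * T_minus s (n - i) G)"
  unfolding T_minus_def
  by (rule T.exp_product) (simp add: pderiv_p_mult scal.scale_right_distrib)

lemma annih_1: "Q_annih n 1 = (if n = 0 then 1 else 0)"
  unfolding Q_annih_def by (rule annih.exp_vacuum) (simp add: pderiv_p_1)

lemma T_1: "T_minus s n 1 = (if n = 0 then 1 else 0)"
  unfolding T_minus_def by (rule T.exp_vacuum) (simp add: pderiv_p_1)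

section \<open>The one-row functions\<close>

text \<open>
  The one-row Q-functions \<open>q\<^sub>n = Q\<^sub>n.1\<close>, the coefficients of \<open>exp (\<Sum>m odd. 2/m p\<^sub>m z\<^sup>m)\<close>.  Integer indices with
  the value 0 at negative ones spare case distinctions in every sum.
\<close>

definition qfun :: "int \<Rightarrow> Gamma" where
  "qfun n = (if n \<ge> 0 then Q_creat (nat n) 1 else 0)"

lemma qfun_neg: "n < 0 \<Longrightarrow> qfun n = 0"
  by (simp add: qfun_def)

lemma qfun_nonneg: "qfun n \<noteq> 0 \<Longrightarrow> n \<ge> 0"
  by (simp add: qfun_def split: if_splits)

lemma qfun_0: "qfun 0 = 1"
  by (simp add: qfun_def Q_creat_def creat.exp_0)

lemma Q_creat_mult: "Q_creat n F = qfun (int n) * F"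
proof -
  have "linop (\<lambda>G. G * F)"
    using linop_mult[of F] by (simp add: mult.commute)
  then have "Q_creat n 1 * F = Q_creat n (1 * F)"
    unfolding Q_creat_def by (rule creat.exp_commute) (simp add: mult.assoc)
  then show ?thesis by (simp add: qfun_def)
qed

lemma qfun_euler:
  "scal (of_nat n) (qfun (int n)) =
    (\<Sum>m\<le>n. if odd m then scal 2 (pvar m * qfun (int n - int m)) else 0)"
  unfolding qfun_def Q_creat_def
  by (simp add: creat.exp_euler[of n 1], intro sum.cong refl)
    (auto simp: nat_diff_distrib odd_pos)

lemma qfun_reflect:
  "(\<Sum>i\<le>n. scal ((-1) ^ i) (qfun (int i) * qfun (int n - int i))) = (if n = 0 then 1 else 0)"
proof -
  have "qfun (int n - int i) = Q_creat (n - i) 1" if "i \<le> n" for i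
    using that by (simp add: qfun_def nat_diff_distrib)
  then have "(\<Sum>i\<le>n. scal ((-1) ^ i) (qfun (int i) * qfun (int n - int i)))
      = (\<Sum>i\<le>n. scal ((-1) ^ i) (Q_creat i (Q_creat (n - i) 1)))"
    by (simp add: Q_creat_mult[of _ "Q_creat _ _"])
  also have "\<dots> = (if n = 0 then 1 else 0)"
    unfolding Q_creat_def by (rule creat.exp_reflect) simp
  finally show ?thesis .
qed

text \<open>
  \<open>\<partial>/\<partial>p\<^sub>m\<close> multiplies the generating function of the \<open>q\<^sub>n\<close> by \<open>(2/m) z\<^sup>m\<close>; here this is extracted from the
  recursion for \<open>q\<^sub>n\<close>.
\<close>

lemma pderiv_p_qfun_nat:
  assumes "odd m"
  shows "pderiv_p m (qfun (int n)) = scal (2 / of_nat m) (qfun (int n - int m))"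
proof (induction n rule: less_induct)
  case (less n)
  have m: "m > 0" using assms odd_pos by blast
  show ?case
  proof (cases "n = 0")
    case True
    then show ?thesis using m by (simp add: qfun_0 pderiv_p_1 qfun_neg)
  next
    case False
    let ?c = "2 / of_nat m :: rat"
    have "scal (of_nat n) (pderiv_p m (qfun (int n)))
        = pderiv_p m (\<Sum>j\<le>n. if odd j then scal 2 (pvar j * qfun (int n - int j)) else 0)"
      by (simp add: qfun_euler linop_scal[OF linop_pderiv_p, symmetric])
    also have "\<dots> = (\<Sum>j\<le>n. (if j = m then scal 2 (qfun (int n - int m)) else 0)
        + scal ?c (if odd j then scal 2 (pvar j * qfun (int n - int m - int j)) else 0))"
      unfolding linop_sum[OF linop_pderiv_p]
    proof (intro sum.cong refl)
      fix j assume "j \<in> {..n}"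
      then have j: "j \<le> n" by simp
      show "pderiv_p m (if odd j then scal 2 (pvar j * qfun (int n - int j)) else 0)
        = (if j = m then scal 2 (qfun (int n - int m)) else 0)
          + scal ?c (if odd j then scal 2 (pvar j * qfun (int n - int m - int j)) else 0)"
      proof (cases "odd j")
        case True
        then have "n - j < n" using False odd_pos by force
        from less[OF this] have "pderiv_p m (qfun (int n - int j))
            = scal ?c (qfun (int n - int m - int j))"
          using j by (simp add: of_nat_diff algebra_simps)
        then show ?thesis using True assms
          by (auto simp: linop_scal[OF linop_pderiv_p] pderiv_p_mult pderiv_p_pvar
              scal.scale_right_distrib mult.commute)
      qed (use assms in \<open>auto simp: linop_zero[OF linop_pderiv_p]\<close>)
    qed
    also have "\<dots> = (if m \<le> n then scal 2 (qfun (int n - int m)) else 0)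
        + scal ?c (\<Sum>j\<le>n. if odd j then scal 2 (pvar j * qfun (int n - int m - int j)) else 0)"
      by (simp add: sum.distrib scal.scale_sum_right)
    also have "\<dots> = scal (of_nat n) (scal ?c (qfun (int n - int m)))"
    proof (cases "m \<le> n")
      case True
      have "(\<Sum>j\<le>n. if odd j then scal 2 (pvar j * qfun (int n - int m - int j)) else 0)
          = (\<Sum>j\<le>n - m. if odd j then scal 2 (pvar j * qfun (int (n - m) - int j)) else 0)"
        using True by (intro sum.mono_neutral_cong_right) (auto simp: qfun_neg of_nat_diff)
      also have "\<dots> = scal (of_nat (n - m)) (qfun (int n - int m))"
        using qfun_euler[of "n - m"] True by (simp add: of_nat_diff)
      finally have sum: "(\<Sum>j\<le>n. if odd j then scal 2 (pvar j * qfun (int n - int m - int j)) else 0)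
          = scal (of_nat (n - m)) (qfun (int n - int m))" .
      have "of_nat n * ?c = 2 + ?c * of_nat (n - m)"
        using True m by (simp add: of_nat_diff field_simps)
      then show ?thesis unfolding sum using True
        by (simp only: scal.scale_scale scal.scale_left_distrib if_True)
    next
      case False
      then show ?thesis by (auto simp: qfun_neg intro!: sum.neutral)
    qed
    finally show ?thesis using False by (metis of_nat_eq_0_iff scal.scale_left_imp_eq scal.scale_cancel_left)
  qed
qed

lemma pderiv_p_qfun:
  assumes "odd m"
  shows "pderiv_p m (qfun n) = scal (2 / of_nat m) (qfun (n - int m))"
proof (cases "n \<ge> 0")
  case True
  then show ?thesis using pderiv_p_qfun_nat[OF assms, of "nat n"] by simp
next
  case False
  then show ?thesis by (simp add: qfun_neg linop_zero[OF linop_pderiv_p])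
qed

text \<open>
  The coefficient of \<open>x\<^sup>k\<close> in \<open>(1 + \<epsilon>x) / (1 - \<epsilon>x)\<close> for \<open>\<epsilon> = \<plusminus>1\<close>, which is \<open>exp (\<Sum>m odd. 2\<epsilon>/m x\<^sup>m)\<close>.
\<close>

definition ratio_coeff :: "rat \<Rightarrow> nat \<Rightarrow> rat" where
  "ratio_coeff \<epsilon> k = (if k = 0 then 1 else 2 * \<epsilon> ^ k)"

lemma sum_odd_weights:
  "(\<Sum>m<k. if odd m then 4 else 0) + (if odd k then 2 else 0) = (2 * of_nat k :: rat)"
  by (induction k) auto

text \<open>
  The recursion \<open>exp_euler\<close> for the scalar series.  Each odd \<open>m < k\<close> contributes \<open>4 \<epsilon>\<^sup>k\<close>, and \<open>m = k\<close>, if odd,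
  half of that.
\<close>

lemma ratio_coeff_euler:
  assumes "\<epsilon> * \<epsilon> = 1" "k > 0"
  shows "(\<Sum>m\<le>k. if odd m then 2 * \<epsilon> * ratio_coeff \<epsilon> (k - m) else 0) = of_nat k * ratio_coeff \<epsilon> k"
proof -
  have odd: "\<epsilon> ^ m = \<epsilon>" if "odd m" for m
    using that assms(1) by (auto elim!: oddE simp: power_mult power2_eq_square)
  have "2 * \<epsilon> * ratio_coeff \<epsilon> (k - m) = 4 * \<epsilon> ^ k" if "odd m" "m < k" for m
  proof -
    have "\<epsilon> * \<epsilon> ^ (k - m) = \<epsilon> ^ m * \<epsilon> ^ (k - m)" using odd[OF that(1)] by simp
    also have "\<dots> = \<epsilon> ^ k" using that by (simp flip: power_add)
    finally show ?thesis using that by (simp add: ratio_coeff_def)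
  qed
  then have "(\<Sum>m<k. if odd m then 2 * \<epsilon> * ratio_coeff \<epsilon> (k - m) else 0)
      = \<epsilon> ^ k * (\<Sum>m<k. if odd m then 4 else 0)"
    unfolding sum_distrib_left by (intro sum.cong) auto
  moreover have "(if odd k then 2 * \<epsilon> * ratio_coeff \<epsilon> 0 else 0) = \<epsilon> ^ k * (if odd k then 2 else 0)"
    using odd[of k] by (simp add: ratio_coeff_def)
  ultimately have "(\<Sum>m\<le>k. if odd m then 2 * \<epsilon> * ratio_coeff \<epsilon> (k - m) else 0)
      = \<epsilon> ^ k * ((\<Sum>m<k. if odd m then 4 else 0) + (if odd k then 2 else 0))"
    unfolding lessThan_Suc_atMost[symmetric] sum.lessThan_Suc distrib_left
    by (simp only: diff_self_eq_0)
  then show ?thesis using assms(2) by (simp only: sum_odd_weights) (simp add: ratio_coeff_def)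
qed

text \<open>
  Operators that multiply the generating function of the \<open>q\<^sub>n\<close> by \<open>(2\<epsilon>/m) z\<^bsup>tm\<^esup>\<close> exponentiate to
  multiplication by \<open>(1 + \<epsilon> z\<^sup>t u) / (1 - \<epsilon> z\<^sup>t u)\<close>.  The annihilating half of \<open>Q(z)\<close> is the case \<open>\<epsilon> = -1\<close>,
  \<open>t = 1\<close>, and \<open>T\<close> is the case \<open>\<epsilon> = 1\<close>, \<open>t = s\<close>.
\<close>

lemma (in commuting_series) exp_qfun:
  assumes A: "\<And>m n. A m (qfun n) = (if odd m then scal (2 * \<epsilon> / of_nat m) (qfun (n - int (t * m))) else 0)"
    and \<epsilon>: "\<epsilon> * \<epsilon> = 1"
  shows "series_exp A k (qfun n) = scal (ratio_coeff \<epsilon> k) (qfun (n - int (t * k)))"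
proof (induction k rule: less_induct)
  case (less k)
  show ?case
  proof (cases "k = 0")
    case True
    then show ?thesis by (simp add: exp_0 ratio_coeff_def)
  next
    case False
    have "scal (of_nat k) (series_exp A k (qfun n))
        = (\<Sum>m\<le>k. scal (if odd m then 2 * \<epsilon> * ratio_coeff \<epsilon> (k - m) else 0) (qfun (n - int (t * k))))"
      unfolding exp_euler
    proof (intro sum.cong refl)
      fix m assume "m \<in> {..k}"
      then have m: "m \<le> k" by simp
      show "scal (of_nat m) (A m (series_exp A (k - m) (qfun n)))
          = scal (if odd m then 2 * \<epsilon> * ratio_coeff \<epsilon> (k - m) else 0) (qfun (n - int (t * k)))"
      proof (cases "odd m")
        case True
        then have "m > 0" by (rule odd_pos)
        then have "series_exp A (k - m) (qfun n)
            = scal (ratio_coeff \<epsilon> (k - m)) (qfun (n - int (t * (k - m))))"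
          using less False by simp
        moreover have "qfun (n - int (t * (k - m)) - int (t * m)) = qfun (n - int (t * k))"
          using m by (simp add: of_nat_diff right_diff_distrib')
        ultimately show ?thesis using True \<open>m > 0\<close>
          by (simp add: linop_scal[OF lin] A mult.commute[of "ratio_coeff _ _"] del: of_nat_mult)
      next
        case even: False
        show ?thesis
        proof (cases "m = 0")
          case nz: False
          then have "series_exp A (k - m) (qfun n)
              = scal (ratio_coeff \<epsilon> (k - m)) (qfun (n - int (t * (k - m))))"
            using less False by simp
          then show ?thesis using even by (simp add: linop_scal[OF lin] A)
        qed simp
      qed
    qed
    also have "\<dots> = scal (of_nat k) (scal (ratio_coeff \<epsilon> k) (qfun (n - int (t * k))))"
      using ratio_coeff_euler[OF \<epsilon>, of k] False by (simp flip: scal.scale_sum_left)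
    finally show ?thesis using False by (metis of_nat_eq_0_iff scal.scale_cancel_left)
  qed
qed

lemma annih_qfun: "Q_annih k (qfun n) = scal (ratio_coeff (-1) k) (qfun (n - int k))"
  unfolding Q_annih_def
  using annih.exp_qfun[of "-1" 1 k n] by (simp add: pderiv_p_qfun)

lemma T_qfun:
  assumes "odd s"
  shows "T_minus s k (qfun n) = scal (ratio_coeff 1 k) (qfun (n - int (s * k)))"
  unfolding T_minus_def
proof (rule T.exp_qfun)
  fix m n
  have "s > 0" using assms by (rule odd_pos)
  then show "(if odd m then scal (of_nat s) (pderiv_p (s * m) (qfun n)) else 0)
      = (if odd m then scal (2 * 1 / of_nat m) (qfun (n - int (s * m))) else 0)"
    using assms by (simp add: pderiv_p_qfun)
qed simp

section \<open>The Clifford relations\<close>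

lemma annih_eventually_zero: "\<exists>N. \<forall>j>N. Q_annih j F = 0"
proof -
  define d where "d = (\<Sum>t \<in> Poly_Mapping.keys F. weight t)"
  have d: "weight_le d F"
    unfolding weight_le_def d_def by (auto intro: member_le_sum weight_nonneg)
  have "Q_annih j F = 0" if "j > nat d" for j
  proof -
    have "weight t < 0" if "t \<in> Poly_Mapping.keys (Q_annih j F)" for t
      using weight_le_Q_annih[OF d, of j] that \<open>j > nat d\<close> by (fastforce simp: weight_le_def)
    then show ?thesis using weight_nonneg by (metis ex_in_conv keys_eq_empty not_less)
  qed
  then show ?thesis by blast
qed

text \<open>
  Every sum that defines some \<open>Q\<^sub>m F\<close> can be cut off at a common bound, which may be chosen as large as
  required.
\<close>

lemma annih_large:
  obtains N :: nat where "N \<ge> M" "\<And>j. j > N \<Longrightarrow> Q_annih j F = 0"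
proof -
  obtain N where N: "\<forall>j>N. Q_annih j F = 0" using annih_eventually_zero by blast
  show thesis by (rule that[of "max M N"]) (use N in auto)
qed

lemma Q_op_conv_sum:
  assumes "\<And>j. j > N \<Longrightarrow> Q_annih j F = 0"
  shows "Q_op m F = (\<Sum>j\<le>N. qfun (m + int j) * Q_annih j F)"
proof -
  have "Q_op m F = Sum_any (\<lambda>j::nat. qfun (m + int j) * Q_annih j F)"
    unfolding Q_op_def by (rule Sum_any.cong) (simp add: Q_creat_mult qfun_neg)
  also have "\<dots> = (\<Sum>j\<le>N. qfun (m + int j) * Q_annih j F)"
    by (rule Sum_any.expand_superset) (use assms in \<open>auto simp: not_less[symmetric]\<close>)
  finally show ?thesis .
qed

lemma linop_Q_op: "linop (Q_op m)"
proof (rule linopI)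
  fix F G
  obtain M where M: "\<And>j. j > M \<Longrightarrow> Q_annih j F = 0" using annih_large by blast
  obtain N where N: "N \<ge> M" "\<And>j. j > N \<Longrightarrow> Q_annih j G = 0" using annih_large by blast
  have "Q_annih j F = 0" "Q_annih j G = 0" if "j > N" for j using M N that by auto
  then show "Q_op m (F + G) = Q_op m F + Q_op m G"
    by (simp add: Q_op_conv_sum[of N] linop_add[OF linop_annih] distrib_left sum.distrib)
next
  fix c F
  obtain N where "\<And>j. j > N \<Longrightarrow> Q_annih j F = 0" using annih_large by blast
  then show "Q_op m (scal c F) = scal c (Q_op m F)"
    by (simp add: Q_op_conv_sum[of N] linop_scal[OF linop_annih] scal.scale_sum_right)
qed

lemma Q_op_1: "Q_op m 1 = qfun m"
  by (subst Q_op_conv_sum[of 0]) (auto simp: annih_1)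

text \<open>
  The coefficient form of \<open>T(u) Q(w) = (1 + w\<^sup>s u) / (1 - w\<^sup>s u) Q(w) T(u)\<close>: \<open>T\<close> is multiplicative, commutes
  with the annihilating half and rescales the creating half.
\<close>

lemma T_Q_op:
  assumes "odd s"
  shows "T_minus s k (Q_op m F)
    = (\<Sum>a\<le>k. scal (ratio_coeff 1 a) (Q_op (m - int (s * a)) (T_minus s (k - a) F)))"
proof -
  obtain N where N: "\<And>j. j > N \<Longrightarrow> Q_annih j F = 0" using annih_large by blast
  have NT: "Q_annih j (T_minus s i F) = 0" if "j > N" for i j
    using N[OF that] by (simp add: T_annih_commute[symmetric] linop_zero[OF linop_T])
  have "T_minus s k (Q_op m F)
      = (\<Sum>j\<le>N. \<Sum>a\<le>k. scal (ratio_coeff 1 a) (qfun (m + int j - int (s * a)) * Q_annih j (T_minus s (k - a) F)))"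
    by (simp add: Q_op_conv_sum[OF N] linop_sum[OF linop_T] T_product T_qfun[OF assms] T_annih_commute)
  also have "\<dots> = (\<Sum>a\<le>k. scal (ratio_coeff 1 a) (Q_op (m - int (s * a)) (T_minus s (k - a) F)))"
    by (subst sum.swap) (simp add: Q_op_conv_sum[OF NT] scal.scale_sum_right algebra_simps)
  finally show ?thesis .
qed


definition parity_sign :: "int \<Rightarrow> rat" where
  "parity_sign m = (if even m then 1 else - 1)"

lemma ratio_coeff_minus: "ratio_coeff (-1) k = (if k = 0 then 1 else 2 * parity_sign (int k))"
  by (simp add: ratio_coeff_def parity_sign_def)

lemma parity_sign_diff: "parity_sign (m - n) = parity_sign m * parity_sign n"
  by (simp add: parity_sign_def)

lemma parity_sign_add: "parity_sign (m + n) = parity_sign m * parity_sign n"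
  by (simp add: parity_sign_def)

lemma parity_sign_of_nat: "parity_sign (int n) = (-1) ^ n"
  by (simp add: parity_sign_def)

lemma parity_sign_square [simp]: "parity_sign m * parity_sign m = 1"
  by (simp add: parity_sign_def)

text \<open>
  The coefficient of \<open>z\<^sup>M w\<^sup>N\<close> in \<open>(1 - w/z) / (1 + w/z) q(z) q(w)\<close>, expanded in powers of \<open>w/z\<close>; this is what
  remains of the creating halves after \<open>Q(z) Q(w)\<close> has been brought into normal order.  The cut-off \<open>K\<close>
  does not matter once \<open>N \<le> K\<close>.
\<close>

definition ordered_pair :: "nat \<Rightarrow> int \<Rightarrow> int \<Rightarrow> Gamma" where
  "ordered_pair K M N = (\<Sum>a\<le>K. scal (ratio_coeff (-1) a) (qfun (M + int a) * qfun (N - int a)))"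

lemma ordered_pair_conv_sum:
  assumes "N \<le> int K" "M + N = int l"
  shows "ordered_pair K M N = (\<Sum>i\<le>l. scal (if int i \<ge> M then ratio_coeff (-1) (nat (int i - M)) else 0)
    (qfun (int i) * qfun (int l - int i)))"
proof -
  have N: "N = int l - M" using assms(2) by simp
  have "ordered_pair K M N = (\<Sum>a | a \<le> K \<and> 0 \<le> M + int a \<and> M + int a \<le> int l.
      scal (ratio_coeff (-1) a) (qfun (M + int a) * qfun (N - int a)))"
    unfolding ordered_pair_def using assms
    by (intro sum.mono_neutral_right) (auto dest!: qfun_nonneg)
  also have "\<dots> = (\<Sum>i | i \<le> l \<and> M \<le> int i. scal (ratio_coeff (-1) (nat (int i - M)))
    (qfun (int i) * qfun (int l - int i)))"
    by (rule sum.reindex_bij_witness[of _ "\<lambda>i. nat (int i - M)" "\<lambda>a. nat (M + int a)"])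
      (use assms(1) in \<open>auto simp: N diff_diff_eq nat_le_iff\<close>)
  also have "\<dots> = (\<Sum>i\<le>l. scal (if int i \<ge> M then ratio_coeff (-1) (nat (int i - M)) else 0)
    (qfun (int i) * qfun (int l - int i)))"
    by (intro sum.mono_neutral_cong_left) auto
  finally show ?thesis .
qed

text \<open>
  The factors are \<open>(z - w) / (z + w)\<close>, expanded in \<open>w/z\<close>, and \<open>(w - z) / (w + z)\<close>, expanded in \<open>z/w\<close>.  As
  rational functions they are opposite, so that the expansions add up to a formal delta function
  at \<open>z = -w\<close>.  There \<open>q(z) q(w) = q(z) q(-z) = 1\<close>.
\<close>

lemma ordered_pair_anticommute:
  assumes "N \<le> int K" "M \<le> int K"
  shows "ordered_pair K M N + ordered_pair K N M = (if M + N = 0 then scal (2 * parity_sign M) 1 else 0)"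
proof (cases "M + N < 0")
  case True
  have "ordered_pair K M N = 0" if "M + N < 0" for M N
    unfolding ordered_pair_def
  proof (intro sum.neutral ballI)
    fix a
    have "M + int a < 0 \<or> N - int a < 0" using that by linarith
    then show "scal (ratio_coeff (-1) a) (qfun (M + int a) * qfun (N - int a)) = 0"
      by (auto simp: qfun_neg)
  qed
  from this[of M N] this[of N M] True show ?thesis by (simp add: add.commute)
next
  case False
  define l where "l = nat (M + N)"
  have l: "M + N = int l" "N + M = int l" using False by (auto simp: l_def)
  have M: "M = int l - N" using l by simp
  let ?q = "\<lambda>i. qfun (int i) * qfun (int l - int i)"
  have "ordered_pair K N M = (\<Sum>i\<le>l. scal (if int i \<ge> N then ratio_coeff (-1) (nat (int i - N)) else 0) (?q i))"
    by (rule ordered_pair_conv_sum) (use assms l in auto)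
  also have "\<dots> = (\<Sum>i\<le>l. scal (if int i \<le> M then ratio_coeff (-1) (nat (M - int i)) else 0) (?q i))"
    by (rule sum.reindex_bij_witness[of _ "\<lambda>i. l - i" "\<lambda>i. l - i"])
      (auto simp: M of_nat_diff mult.commute)
  finally have "ordered_pair K M N + ordered_pair K N M
      = (\<Sum>i\<le>l. scal ((if int i \<ge> M then ratio_coeff (-1) (nat (int i - M)) else 0)
          + (if int i \<le> M then ratio_coeff (-1) (nat (M - int i)) else 0)) (?q i))"
    using assms l by (simp add: ordered_pair_conv_sum[of N K M l] scal.scale_left_distrib sum.distrib)
  also have "\<dots> = (\<Sum>i\<le>l. scal (2 * parity_sign M) (scal ((-1) ^ i) (?q i)))"
    by (intro sum.cong refl)
      (auto simp: ratio_coeff_minus parity_sign_diff parity_sign_of_nat[symmetric] mult.commute)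
  also have "\<dots> = scal (2 * parity_sign M) (if l = 0 then 1 else 0)"
    by (simp only: qfun_reflect flip: scal.scale_sum_right)
  finally show ?thesis using l by auto
qed

text \<open>
  Normal ordering: the annihilating half of \<open>Q\<^sub>m\<close> is moved past the creating half of \<open>Q\<^sub>n\<close>.  The bounds \<open>N\<close>
  and \<open>K\<close> make every sum finite.
\<close>

lemma Q_op_Q_op:
  assumes N: "\<And>j. j > N \<Longrightarrow> Q_annih j F = 0" and K: "n + int N \<le> int K"
  shows "Q_op m (Q_op n F)
    = (\<Sum>i\<le>N. \<Sum>j\<le>N. ordered_pair K (m + int i) (n + int j) * Q_annih i (Q_annih j F))"
proof -
  let ?g = "\<lambda>i a j. scal (ratio_coeff (-1) a)
    (qfun (m + int i + int a) * qfun (n + int j - int a)) * Q_annih i (Q_annih j F)"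
  have RR: "Q_annih i (Q_annih j F) = 0" if "i > N" for i j
    using N[OF that] unfolding Q_annih_def
    by (subst annih.exp_series_commute) (simp add: linop_zero[OF annih.linop_exp])
  have RQ: "Q_annih i (Q_op n F)
      = (\<Sum>j\<le>N. \<Sum>a\<le>i. scal (ratio_coeff (-1) a) (qfun (n + int j - int a)) * Q_annih (i - a) (Q_annih j F))"
    for i
    by (simp add: Q_op_conv_sum[OF N] linop_sum[OF linop_annih] annih_product annih_qfun)
  have "Q_annih i (Q_op n F) = 0" if "i > N + K" for i
    unfolding RQ
  proof (intro sum.neutral ballI)
    fix j a assume "j \<in> {..N}" "a \<in> {..i}"
    show "scal (ratio_coeff (-1) a) (qfun (n + int j - int a)) * Q_annih (i - a) (Q_annih j F) = 0"
    proof (cases "a \<le> K")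
      case True
      then show ?thesis using that by (simp add: RR)
    next
      case False
      then show ?thesis using K \<open>j \<in> {..N}\<close> by (simp add: qfun_neg)
    qed
  qed
  then have "Q_op m (Q_op n F) = (\<Sum>i\<le>N + K. qfun (m + int i) * Q_annih i (Q_op n F))"
    by (rule Q_op_conv_sum)
  also have "\<dots> = (\<Sum>i\<le>N + K. \<Sum>a\<le>i. \<Sum>j\<le>N. scal (ratio_coeff (-1) a)
      (qfun (m + int i) * qfun (n + int j - int a)) * Q_annih (i - a) (Q_annih j F))"
    unfolding RQ by (subst sum.swap) (simp add: sum_distrib_left mult.assoc)
  also have "\<dots> = (\<Sum>a\<le>N + K. \<Sum>i\<le>N + K - a. \<Sum>j\<le>N. ?g i a j)"
    unfolding triangle_shift by (simp add: add.assoc)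
  also have "\<dots> = (\<Sum>a\<le>K. \<Sum>i\<le>N. \<Sum>j\<le>N. ?g i a j)"
  proof (rule sum.mono_neutral_cong_right)
    show "\<forall>a\<in>{..N + K} - {..K}. (\<Sum>i\<le>N + K - a. \<Sum>j\<le>N. ?g i a j) = 0"
      using K by (auto simp: qfun_neg intro!: sum.neutral)
    show "(\<Sum>i\<le>N + K - a. \<Sum>j\<le>N. ?g i a j) = (\<Sum>i\<le>N. \<Sum>j\<le>N. ?g i a j)" if "a \<in> {..K}" for a
      using that by (intro sum.mono_neutral_right) (auto simp: RR)
  qed auto
  also have "\<dots> = (\<Sum>i\<le>N. \<Sum>j\<le>N. \<Sum>a\<le>K. ?g i a j)"
    by (subst sum.swap) (intro sum.cong refl sum.swap)
  also have "\<dots> = (\<Sum>i\<le>N. \<Sum>j\<le>N. ordered_pair K (m + int i) (n + int j) * Q_annih i (Q_annih j F))"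
    unfolding ordered_pair_def sum_distrib_right ..
  finally show ?thesis .
qed

text \<open>
  In normal order the creating halves anticommute up to the delta function of \<open>ordered_pair_anticommute\<close>.
  On its support the annihilating halves cancel too, by \<open>exp_reflect\<close>.
\<close>

lemma Q_op_anticommute:
  "Q_op m (Q_op n F) + Q_op n (Q_op m F) = (if m + n = 0 then scal (2 * parity_sign m) F else 0)"
proof -
  obtain N where Nl: "N \<ge> nat (- (m + n))" and N: "\<And>j. j > N \<Longrightarrow> Q_annih j F = 0"
    using annih_large by blast
  define K where "K = nat (max (m + int N) (n + int N))"
  have K: "m + int N \<le> int K" "n + int N \<le> int K" unfolding K_def by arith+
  let ?R = "\<lambda>i j. Q_annih i (Q_annih j F)"
  have "Q_op n (Q_op m F) = (\<Sum>j\<le>N. \<Sum>i\<le>N. ordered_pair K (n + int j) (m + int i) * ?R j i)"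
    by (rule Q_op_Q_op[OF N K(1)])
  also have "\<dots> = (\<Sum>i\<le>N. \<Sum>j\<le>N. ordered_pair K (n + int j) (m + int i) * ?R i j)"
    unfolding Q_annih_def by (subst sum.swap) (simp add: annih.exp_series_commute)
  finally have swapped: "Q_op n (Q_op m F) = \<dots>" .
  have "Q_op m (Q_op n F) + Q_op n (Q_op m F) = (\<Sum>i\<le>N. \<Sum>j\<le>N.
      (ordered_pair K (m + int i) (n + int j) + ordered_pair K (n + int j) (m + int i)) * ?R i j)"
    unfolding swapped by (simp add: Q_op_Q_op[OF N K(2)] distrib_right sum.distrib)
  also have "\<dots> = (\<Sum>i\<le>N. \<Sum>j\<le>N. if m + int i + (n + int j) = 0
      then scal (2 * parity_sign m) (scal ((-1) ^ i) (?R i j)) else 0)"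
    by (intro sum.cong refl, subst ordered_pair_anticommute)
      (use K in \<open>auto simp: parity_sign_add parity_sign_of_nat\<close>)
  also have "\<dots> = (if m + n = 0 then scal (2 * parity_sign m) F else 0)"
  proof (cases "m + n \<le> 0")
    case False
    then show ?thesis by (auto intro!: sum.neutral)
  next
    case True
    define l where "l = nat (- (m + n))"
    have l: "m + n = - int l" "l \<le> N" using True Nl by (auto simp: l_def)
    have reflect: "(\<Sum>i\<le>l. scal ((-1) ^ i) (?R i (l - i))) = (if l = 0 then F else 0)"
      unfolding Q_annih_def by (rule annih.exp_reflect) simp
    have iff: "m + int i + (n + int j) = 0 \<longleftrightarrow> i \<le> l \<and> j = l - i" for i j
      using l(1) by auto
    have "(\<Sum>i\<le>N. \<Sum>j\<le>N. if m + int i + (n + int j) = 0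
          then scal (2 * parity_sign m) (scal ((-1) ^ i) (?R i j)) else 0)
        = (\<Sum>i\<le>N. if i \<le> l then scal (2 * parity_sign m) (scal ((-1) ^ i) (?R i (l - i))) else 0)"
      unfolding iff using l(2) by (intro sum.cong refl) auto
    also have "\<dots> = (\<Sum>i\<le>l. scal (2 * parity_sign m) (scal ((-1) ^ i) (?R i (l - i))))"
      using l(2) by (intro sum.mono_neutral_cong_right) auto
    also have "\<dots> = scal (2 * parity_sign m) (if l = 0 then F else 0)"
      by (simp only: reflect flip: scal.scale_sum_right)
    finally show ?thesis using l by auto
  qed
  finally show ?thesis .
qed

section \<open>The matrix as a word in two kinds of letters\<close>

text \<open>
  \<open>Mu a\<close> and \<open>Lam b\<close> index the rows of the matrix that belong to a part \<open>a\<close> of \<open>\<mu>\<close> (or to the added 0) and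
  to a part \<open>b\<close> of \<open>\<lambda>\<close>.
\<close>

datatype letter = Mu nat | Lam nat

text \<open>
  The parts of \<open>\<lambda>\<close> occur in decreasing order, so that the comparison of positions in the definition of
  the matrix becomes a comparison of values.
\<close>

fun pairing :: "nat \<Rightarrow> letter \<Rightarrow> letter \<Rightarrow> rat" where
  "pairing s (Mu a) (Mu b) = 0"
| "pairing s (Mu a) (Lam b) = f1 s (int b - int a)"
| "pairing s (Lam b) (Mu a) = - f1 s (int b - int a)"
| "pairing s (Lam m) (Lam n) = (if n < m then f2 s m n else if m < n then - f2 s n m else 0)"

interpretation antisymmetric "pairing s" for s
proof
  show "pairing s x y = - pairing s y x" for x y
    by (cases x; cases y) auto
qed

abbreviation word_pf :: "nat \<Rightarrow> letter list \<Rightarrow> rat" where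
  "word_pf s \<equiv> pf (pairing s)"

text \<open>
  Exactly one of the two words has even length, and the Pfaffian of the other one is 0.  The sum is
  therefore the Pfaffian of the matrix in either parity.
\<close>

definition padded_pf :: "nat \<Rightarrow> letter list \<Rightarrow> rat" where
  "padded_pf s w = word_pf s w + word_pf s (Mu 0 # w)"

lemma pf_odd: "odd (length xs) \<Longrightarrow> pf A xs = 0"
proof (induction xs rule: length_induct)
  case (1 xs)
  then show ?case
  proof (cases xs)
    case (Cons x ys)
    have "pf A (take p ys @ drop (Suc p) ys) = 0" if "p < length ys" for p
      using 1 Cons that by (intro 1(1)[rule_format]) auto
    then show ?thesis by (simp add: Cons contract_conv_sum)
  qed simp
qed

lemma M_tilde_conv_word:
  fixes lam mu :: "nat list"
  assumes "strict_partition lam"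
  defines "w \<equiv> (if even (length lam + length mu) then [] else [Mu 0]) @ map Mu (rev mu) @ map Lam lam"
  shows "M_tilde s lam mu = mat (length w) (length w) (\<lambda>(i, j). pairing s (w ! i) (w ! j))"
proof -
  define a where "a = M_rows lam mu"
  have len: "length w = a + length lam"
    by (simp add: w_def a_def M_rows_def)
  have row: "w ! i = Mu (part mu (a - 1 - i))" if "i < a" for i
    using that by (auto simp: w_def a_def M_rows_def part_def nth_append rev_nth nth_Cons' split: if_splits)
  have col: "w ! i = Lam (part lam (i - a))" if "a \<le> i" "i < a + length lam" for i
    using that by (auto simp: w_def a_def M_rows_def part_def nth_append nth_Cons' split: if_splits)
  have desc: "part lam j < part lam i" if "i < j" "j < length lam" for i j
    using assms(1) that by (auto simp: strict_partition_def part_def sorted_wrt_iff_nth_less)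
  show ?thesis
  proof (rule eq_matI)
    fix i j
    assume "i < dim_row (mat (length w) (length w) (\<lambda>(i, j). pairing s (w ! i) (w ! j)))"
      and "j < dim_col (mat (length w) (length w) (\<lambda>(i, j). pairing s (w ! i) (w ! j)))"
    then have ij: "i < a + length lam" "j < a + length lam" by (simp_all add: len)
    consider "i < a" "j < a" | "i < a" "a \<le> j" | "a \<le> i" "j < a"
      | "a \<le> i" "a \<le> j" "i < j" | "a \<le> i" "a \<le> j" "j < i" | "a \<le> i" "i = j"
      by linarith
    then show "M_tilde s lam mu $$ (i, j)
        = mat (length w) (length w) (\<lambda>(i, j). pairing s (w ! i) (w ! j)) $$ (i, j)"
    proof cases
      case 4
      then show ?thesis using ij desc[of "i - a" "j - a"]
        by (simp add: len M_tilde_def M_X_def M_Y_def a_def[symmetric] row col)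
    next
      case 5
      then have "j - a < i - a" "part lam (i - a) < part lam (j - a)"
        using ij desc[of "j - a" "i - a"] by auto
      then show ?thesis using 5 ij
        by (simp add: len M_tilde_def M_X_def M_Y_def a_def[symmetric] row col)
    qed (use ij in \<open>simp_all add: len M_tilde_def M_X_def M_Y_def a_def[symmetric] row col\<close>)
  qed (simp_all add: len M_tilde_def M_X_def M_Y_def a_def[symmetric])
qed

lemma pfaffian_M_tilde:
  assumes "strict_partition lam"
  shows "pfaffian (M_tilde s lam mu) = padded_pf s (map Mu (rev mu) @ map Lam lam)"
  unfolding M_tilde_conv_word[OF assms] padded_pf_def
  by (subst pfaffian_eq_pf)
    (auto simp: pf_odd simp del: pf.simps)

lemma padded_pf_swap: "padded_pf s (us @ x # y # vs) = - padded_pf s (us @ y # x # vs)"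
  unfolding padded_pf_def
  using pf_swap[of s us x y vs] pf_swap[of s "Mu 0 # us" x y vs] by simp

lemma padded_pf_repeat:
  assumes "x \<in> set us"
  shows "padded_pf s (us @ x # vs) = 0"
proof -
  have rep: "word_pf s (us @ x # vs) = 0" if x: "x \<in> set us" for us
  proof -
    obtain us1 us2 where us: "us = us1 @ x # us2" using x by (meson split_list)
    have "word_pf s (us @ x # vs) = (-1) ^ length us * word_pf s (x # us1 @ x # us2 @ vs)"
      using pf_move[of s us x vs] by (simp add: us del: pf.simps)
    also have "word_pf s (x # us1 @ x # us2 @ vs) = (-1) ^ Suc (length us1) * word_pf s ([] @ x # x # us1 @ us2 @ vs)"
      using pf_move[of s "x # us1" x "us2 @ vs"] by (simp del: pf.simps)
    also have "word_pf s ([] @ x # x # us1 @ us2 @ vs) = 0"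
      by (rule pf_repeat)
    finally show ?thesis by simp
  qed
  show ?thesis
    using rep[OF assms] rep[of "Mu 0 # us"] assms by (simp add: padded_pf_def)
qed

lemma contract_Mu_Mu: "contract (pairing s) (Mu a) \<Phi> (map Mu rs) = 0"
  by (induction rs arbitrary: \<Phi>) auto

lemma word_pf_Mu_Cons:
  "word_pf s (Mu a # map Mu rs @ zs)
    = (-1) ^ length rs * contract (pairing s) (Mu a) (\<lambda>z. word_pf s (map Mu rs @ z)) zs"
  by (simp add: contract_append contract_Mu_Mu)

text \<open>
  Expansion along the row of a part \<open>a\<close> of \<open>\<mu>\<close> placed next to \<open>\<lambda>\<close>: rows of \<open>\<mu>\<close> pair with \<open>\<lambda>\<close> only.
\<close>

lemma contract_Mu_padded:
  "contract (pairing s) (Mu a) (\<lambda>z. padded_pf s (map Mu rs @ z)) zs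
    = padded_pf s (map Mu rs @ Mu a # zs)"
proof -
  have move: "word_pf s (map Mu rs @ Mu a # zs)
      = contract (pairing s) (Mu a) (\<lambda>z. word_pf s (map Mu rs @ z)) zs" for rs
    by (subst pf_move) (simp add: word_pf_Mu_Cons del: pf.simps)
  show ?thesis
    using move[of rs] move[of "0 # rs"] by (simp add: padded_pf_def contract_add del: pf.simps)
qed

lemma f2_conv_pairing:
  assumes "n \<le> J"
  shows "f2 s m n = f1 s (int m) * f1 s (int n)
    + (\<Sum>j=1..J. 2 * (-1) ^ j * f1 s (int m + int j) * f1 s (int n - int j))"
proof -
  have "(\<Sum>j=1..J. 2 * (-1) ^ j * f1 s (int m + int j) * f1 s (int n - int j))
      = (\<Sum>j=1..n. 2 * (-1) ^ j * f1 s (int m + int j) * f1 s (int n - int j))"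
    using assms by (intro sum.mono_neutral_right) (auto simp: f1_def)
  then show ?thesis
    by (simp add: f2_def sum_distrib_left mult.assoc) (simp add: f1_def)
qed

text \<open>
  The pairing \<open>f\<^bsub>(l,c)\<^esub>\<close> is a combination of the pairings \<open>f\<^bsub>c-j\<^esub>\<close> of \<open>c\<close> with parts \<open>j\<close> of \<open>\<mu>\<close>.  So contracting
  with \<open>Lam l\<close> amounts to creating such parts and contracting with them.
\<close>

lemma contract_Lam_Lam:
  assumes "\<And>c. c \<in> set ls \<Longrightarrow> c < l \<and> c \<le> J"
  shows "contract (pairing s) (Lam l) \<Phi> (map Lam ls)
    = f1 s (int l) * contract (pairing s) (Mu 0) \<Phi> (map Lam ls)
      + (\<Sum>j=1..J. 2 * (-1) ^ j * f1 s (int l + int j) * contract (pairing s) (Mu j) \<Phi> (map Lam ls))"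
  using assms
proof (induction ls arbitrary: \<Phi>)
  case (Cons c ls)
  have IH: "contract (pairing s) (Lam l) (\<lambda>z. \<Phi> (Lam c # z)) (map Lam ls)
    = f1 s (int l) * contract (pairing s) (Mu 0) (\<lambda>z. \<Phi> (Lam c # z)) (map Lam ls)
      + (\<Sum>j=1..J. 2 * (-1) ^ j * f1 s (int l + int j)
          * contract (pairing s) (Mu j) (\<lambda>z. \<Phi> (Lam c # z)) (map Lam ls))"
    by (rule Cons.IH) (simp add: Cons.prems)
  have c: "c < l" "c \<le> J" using Cons.prems by auto
  show ?case
    using c by (simp add: IH f2_conv_pairing[OF c(2)] algebra_simps sum_distrib_left sum.distrib sum_subtractf)
qed simp

text \<open>
  Expansion along the row of \<open>l\<close>.  The three summands correspond to the effect on \<open>Q\<^sub>\<mu>.1\<close> of \<open>Q\<^sub>i\<close> with \<open>i > 0\<close>,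
  \<open>i = 0\<close> and \<open>i < 0\<close>.
\<close>

lemma padded_pf_expand:
  assumes "\<And>c. c \<in> set ls \<Longrightarrow> c < l \<and> c \<le> J"
  shows "padded_pf s (map Mu rs @ map Lam (l # ls))
    = (-1) ^ length rs * contract (pairing s) (Lam l) (\<lambda>z. padded_pf s (z @ map Lam ls)) (map Mu rs)
      + (-1) ^ length rs * f1 s (int l) * padded_pf s (map Mu rs @ map Lam ls)
      + (\<Sum>j=1..J. 2 * (-1) ^ j * f1 s (int l + int j) * padded_pf s (map Mu rs @ Mu j # map Lam ls))"
proof -
  let ?r = "map Mu rs" and ?z = "map Lam ls" and ?\<sigma> = "(-1) ^ length rs :: rat"
  let ?C = "contract (pairing s)"
  have \<sigma>: "?\<sigma> * ?\<sigma> = 1" by (simp flip: power_add)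
  have "padded_pf s (?r @ Lam l # ?z)
      = ?\<sigma> * (?C (Lam l) (padded_pf s) (?r @ ?z) + f1 s (int l) * word_pf s (?r @ ?z))"
  proof -
    have "word_pf s (?r @ Lam l # ?z) = ?\<sigma> * ?C (Lam l) (word_pf s) (?r @ ?z)"
      by (subst pf_move) simp
    moreover have "word_pf s (Mu 0 # ?r @ Lam l # ?z)
        = ?\<sigma> * (?C (Lam l) (\<lambda>z. word_pf s (Mu 0 # z)) (?r @ ?z) + f1 s (int l) * word_pf s (?r @ ?z))"
      using pf_move[of s "Mu 0 # ?r" "Lam l" ?z]
      by (simp add: algebra_simps cong: contract_cong)
    ultimately show ?thesis
      by (simp add: padded_pf_def[abs_def] contract_add algebra_simps del: pf.simps)
  qed
  also have "?C (Lam l) (padded_pf s) (?r @ ?z)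
      = ?C (Lam l) (\<lambda>z. padded_pf s (z @ ?z)) ?r + ?\<sigma> * ?C (Lam l) (\<lambda>z. padded_pf s (?r @ z)) ?z"
    by (simp add: contract_append)
  also have "?C (Lam l) (\<lambda>z. padded_pf s (?r @ z)) ?z = f1 s (int l) * padded_pf s (?r @ Mu 0 # ?z)
      + (\<Sum>j=1..J. 2 * (-1) ^ j * f1 s (int l + int j) * padded_pf s (?r @ Mu j # ?z))"
    by (subst contract_Lam_Lam[where J = J]) (simp_all add: assms contract_Mu_padded)
  \<comment> \<open>The word with two letters \<open>Mu 0\<close> contributes nothing; this closes the gap between the parities.\<close>
  also have "padded_pf s (?r @ Mu 0 # ?z) = ?\<sigma> * word_pf s (Mu 0 # ?r @ ?z)"
  proof -
    have "word_pf s (Mu 0 # ?r @ Mu 0 # ?z) = - (?\<sigma> * word_pf s ([] @ Mu 0 # Mu 0 # ?r @ ?z))"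
      using pf_move[of s "Mu 0 # ?r" "Mu 0" ?z] by (simp del: pf.simps)
    then have "word_pf s (Mu 0 # ?r @ Mu 0 # ?z) = 0" unfolding pf_repeat by simp
    moreover have "word_pf s (?r @ Mu 0 # ?z) = ?\<sigma> * word_pf s (Mu 0 # ?r @ ?z)"
      by (subst pf_move) simp
    ultimately show ?thesis by (simp add: padded_pf_def del: pf.simps)
  qed
  finally have expand: "padded_pf s (?r @ Lam l # ?z)
      = ?\<sigma> * (?C (Lam l) (\<lambda>z. padded_pf s (z @ ?z)) ?r
          + ?\<sigma> * (f1 s (int l) * (?\<sigma> * word_pf s (Mu 0 # ?r @ ?z))
              + (\<Sum>j=1..J. 2 * (-1) ^ j * f1 s (int l + int j) * padded_pf s (?r @ Mu j # ?z)))
          + f1 s (int l) * word_pf s (?r @ ?z))" .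
  have arrange: "\<sigma> * (a + \<sigma> * (f * (\<sigma> * w0) + t) + f * w) = \<sigma> * a + \<sigma> * f * (w + w0) + t"
    if "\<sigma> * \<sigma> = 1" for \<sigma> a f w w0 t :: rat
  proof -
    have "\<sigma> * (\<sigma> * (f * (\<sigma> * w0) + t)) = f * (\<sigma> * w0) + t"
      using that by (simp only: mult.assoc[symmetric] mult_1_left)
    then show ?thesis by (simp only: distrib_left mult_ac add_ac)
  qed
  show ?thesis
    unfolding padded_pf_def[of s "?r @ ?z"] list.map expand by (rule arrange[OF \<sigma>])
qed


section \<open>Vanishing outside containment\<close>

text \<open>
  A nonzero Pfaffian has a nonzero term, which matches each \<open>r\<close> with some \<open>c \<ge> r\<close>.
\<close>

lemma word_pf_support:
  assumes "word_pf s (map Mu rs @ map Lam ls) \<noteq> 0"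
  shows "sum_list rs \<le> sum_list ls
    \<and> (\<forall>x. length (filter (\<lambda>y. x \<le> y) rs) \<le> length (filter (\<lambda>y. x \<le> y) ls))"
  using assms
proof (induction rs arbitrary: ls)
  case (Cons r rs)
  from Cons.prems have "contract (pairing s) (Mu r) (\<lambda>z. word_pf s (map Mu rs @ z)) (map Lam ls) \<noteq> 0"
    using word_pf_Mu_Cons[of s r rs "map Lam ls"] by (auto simp del: pf.simps)
  then obtain us y vs where *: "map Lam ls = us @ y # vs" "pairing s (Mu r) y \<noteq> 0"
    "word_pf s (map Mu rs @ us @ vs) \<noteq> 0"
    using contract_nonzero[of "pairing s" "Mu r"] by blast
  then obtain ls1 c ls2 where ls: "ls = ls1 @ c # ls2" "us = map Lam ls1" "y = Lam c" "vs = map Lam ls2"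
    by (auto simp: map_eq_append_conv map_eq_Cons_conv)
  have "r \<le> c" using *(2) ls by (auto simp: f1_def split: if_splits)
  moreover have "sum_list rs \<le> sum_list (ls1 @ ls2)
    \<and> (\<forall>x. length (filter (\<lambda>y. x \<le> y) rs) \<le> length (filter (\<lambda>y. x \<le> y) (ls1 @ ls2)))"
    using *(3) ls by (intro Cons.IH) simp
  ultimately show ?case by (auto simp: ls intro: le_SucI)
qed simp

lemma padded_pf_support:
  assumes "padded_pf s (map Mu rs @ map Lam ls) \<noteq> 0"
  shows "sum_list rs \<le> sum_list ls"
    and "x > 0 \<Longrightarrow> length (filter (\<lambda>y. x \<le> y) rs) \<le> length (filter (\<lambda>y. x \<le> y) ls)"
proof -
  have "word_pf s (map Mu rs @ map Lam ls) \<noteq> 0 \<or> word_pf s (map Mu (0 # rs) @ map Lam ls) \<noteq> 0"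
    using assms by (auto simp: padded_pf_def simp del: pf.simps)
  then have "sum_list rs \<le> sum_list ls \<and> (x > 0 \<longrightarrow>
      length (filter (\<lambda>y. x \<le> y) rs) \<le> length (filter (\<lambda>y. x \<le> y) ls))"
  proof
    assume "word_pf s (map Mu (0 # rs) @ map Lam ls) \<noteq> 0"
    from word_pf_support[OF this] show ?thesis by (auto dest: spec[of _ x])
  qed (use word_pf_support in blast)
  then show "sum_list rs \<le> sum_list ls"
    and "x > 0 \<Longrightarrow> length (filter (\<lambda>y. x \<le> y) rs) \<le> length (filter (\<lambda>y. x \<le> y) ls)"
    by auto
qed

text \<open>
  If \<open>\<mu>\<^sub>i > \<lambda>\<^sub>i\<close>, then \<open>\<mu>\<^sub>i\<close> is exceeded or attained by at least \<open>i\<close> parts of \<open>\<mu>\<close> but by fewer than \<open>i\<close>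
  parts of \<open>\<lambda>\<close>.
\<close>

lemma part_contained_if_counts:
  assumes "strict_partition mu" "strict_partition lam"
    and counts: "\<And>x. x > 0 \<Longrightarrow> length (filter (\<lambda>y. x \<le> y) mu) \<le> length (filter (\<lambda>y. x \<le> y) lam)"
  shows "part_contained mu lam"
  unfolding part_contained_def
proof (rule allI, rule ccontr)
  fix i assume "\<not> part mu i \<le> part lam i"
  then have less: "part lam i < part mu i" by simp
  define x where "x = part mu i"
  have i: "i < length mu" using less by (auto simp: part_def split: if_splits)
  have "filter (\<lambda>y. x \<le> y) (take (Suc i) mu) = take (Suc i) mu"
  proof (rule filter_True, rule ballI)
    fix y assume "y \<in> set (take (Suc i) mu)"
    then obtain j where j: "j \<le> i" "y = mu ! j" by (force simp: in_set_conv_nth less_Suc_eq_le)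
    then show "x \<le> y" using assms(1) i
      by (cases "j = i")
        (auto simp: x_def part_def strict_partition_def sorted_wrt_iff_nth_less intro: less_imp_le)
  qed
  then have "Suc i \<le> length (filter (\<lambda>y. x \<le> y) (take (Suc i) mu @ drop (Suc i) mu))"
    using i by (simp only: filter_append length_append) simp
  also have "\<dots> \<le> length (filter (\<lambda>y. x \<le> y) lam)"
    using counts[of x] less by (simp add: x_def)
  also have "\<dots> = length (filter (\<lambda>y. x \<le> y) (take i lam @ drop i lam))" by simp
  also have "filter (\<lambda>y. x \<le> y) (drop i lam) = []"
  proof -
    have "y < x" if "y \<in> set (drop i lam)" for y
    proof -
      obtain k where "k < length (drop i lam)" "y = drop i lam ! k"
        using \<open>y \<in> set (drop i lam)\<close> by (metis in_set_conv_nth)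
      then obtain j where j: "i \<le> j" "j < length lam" "y = lam ! j"
        by (intro that[of "i + k"]) auto
      then have "lam ! j \<le> lam ! i" using assms(2)
        by (cases "j = i") (auto simp: strict_partition_def sorted_wrt_iff_nth_less intro: less_imp_le)
      then show ?thesis using less j by (simp add: x_def part_def)
    qed
    then show ?thesis by (auto simp: filter_empty_conv not_le)
  qed
  then have "length (filter (\<lambda>y. x \<le> y) (take i lam @ drop i lam)) \<le> i"
    using length_filter_le[of "\<lambda>y. x \<le> y" "take i lam"]
    unfolding filter_append by simp
  finally show False by simp
qed

section \<open>Expansion of the coefficients\<close>

abbreviation asc :: "nat set \<Rightarrow> nat list" where
  "asc \<equiv> sorted_list_of_set"

text \<open>
  The sign of moving \<open>j\<close> past the elements of \<open>S\<close> that are larger than \<open>j\<close>.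
\<close>

definition above_sgn :: "nat \<Rightarrow> nat set \<Rightarrow> rat" where
  "above_sgn j S = (-1) ^ card {x \<in> S. j < x}"

lemma above_sgn_square [simp]: "above_sgn j S * above_sgn j S = 1"
  by (simp add: above_sgn_def flip: power_add)

lemma above_sgn_self: "above_sgn j (S - {j}) = above_sgn j S" "above_sgn j (insert j S) = above_sgn j S"
proof -
  have "{x \<in> S - {j}. j < x} = {x \<in> S. j < x}" "{x \<in> insert j S. j < x} = {x \<in> S. j < x}"
    by auto
  then show "above_sgn j (S - {j}) = above_sgn j S" "above_sgn j (insert j S) = above_sgn j S"
    by (simp_all only: above_sgn_def)
qed

text \<open>
  Shared by Pfaffians and by products of the \<open>Q\<^sub>m\<close>: inserting a part produces the same sign in both, so
  that these signs cancel in the final sum.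
\<close>

lemma insort_sign:
  fixes \<Phi> :: "nat list \<Rightarrow> 'a::ring_1"
  assumes swap: "\<And>us x y vs. x < y \<Longrightarrow> \<Phi> (us @ y # x # vs) = - \<Phi> (us @ x # y # vs)"
    and "sorted_wrt (<) xs" "j \<notin> set xs"
  shows "\<Phi> (us @ xs @ [j]) = (-1) ^ card {x \<in> set xs. j < x} * \<Phi> (us @ insort j xs)"
  using assms(2,3)
proof (induction xs arbitrary: us)
  case (Cons x xs)
  have IH: "\<Phi> ((us @ [x]) @ xs @ [j]) = (-1) ^ card {z \<in> set xs. j < z} * \<Phi> ((us @ [x]) @ insort j xs)"
    using Cons.IH[of "us @ [x]"] Cons.prems by simp
  show ?case
  proof (cases "x < j")
    case True
    then have "{z \<in> set (x # xs). j < z} = {z \<in> set xs. j < z}" by auto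
    then show ?thesis using IH True by simp
  next
    case False
    then have "j < x" using Cons.prems by auto
    moreover from this have "insort j xs = j # xs"
      using Cons.prems by (cases xs) auto
    moreover have "{z \<in> set (x # xs). j < z} = insert x {z \<in> set xs. j < z}" "x \<notin> set xs"
      using \<open>j < x\<close> Cons.prems by auto
    ultimately show ?thesis using IH swap[of j x us xs] by simp
  qed
qed simp

lemma asc_insert_sign:
  fixes \<Phi> :: "nat list \<Rightarrow> 'a::ring_1"
  assumes "\<And>us x y vs. x < y \<Longrightarrow> \<Phi> (us @ y # x # vs) = - \<Phi> (us @ x # y # vs)"
    and "finite S" "j \<notin> S"
  shows "\<Phi> (asc S @ [j]) = (-1) ^ card {x \<in> S. j < x} * \<Phi> (asc (insert j S))"
proof -
  have "\<Phi> ([] @ asc S @ [j]) = (-1) ^ card {x \<in> set (asc S). j < x} * \<Phi> ([] @ insort j (asc S))"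
    by (rule insort_sign, erule assms(1)) (use assms(2,3) in simp_all)
  then show ?thesis using assms(2,3) by (simp add: sorted_list_of_set_insert)
qed

lemma padded_pf_insert:
  assumes "finite S" "j \<notin> S"
  shows "padded_pf s (map Mu (asc S) @ Mu j # zs)
    = above_sgn j S * padded_pf s (map Mu (asc (insert j S)) @ zs)"
proof -
  have "padded_pf s (map Mu (asc S @ [j]) @ zs)
      = (-1) ^ card {x \<in> S. j < x} * padded_pf s (map Mu (asc (insert j S)) @ zs)"
  proof (rule asc_insert_sign)
    show "padded_pf s (map Mu (us @ y # x # vs) @ zs) = - padded_pf s (map Mu (us @ x # y # vs) @ zs)"
      for us x y vs
      using padded_pf_swap[of s "map Mu us" "Mu y" "Mu x" "map Mu vs @ zs"] by simp
  qed (use assms in auto)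
  then show ?thesis by (simp add: above_sgn_def)
qed

lemma padded_pf_insert_0:
  assumes "finite S" "j \<in> S"
  shows "padded_pf s (map Mu (asc S) @ Mu j # zs) = 0"
  using assms by (intro padded_pf_repeat) auto

lemma contract_sorted:
  assumes "sorted_wrt (<) rs"
  shows "(-1) ^ length rs * contract (pairing s) (Lam l) \<Phi> (map Mu rs)
    = (\<Sum>i\<in>set rs. f1 s (int l - int i) * (-1) ^ card {x \<in> set rs. i < x} * \<Phi> (map Mu (remove1 i rs)))"
  using assms
proof (induction rs arbitrary: \<Phi>)
  case (Cons y ys)
  have y: "y \<notin> set ys" "{x. (x = y \<or> x \<in> set ys) \<and> y < x} = set ys" "distinct ys"
    using Cons.prems by (auto simp: strict_sorted_iff)
  have IH: "(-1) ^ length ys * contract (pairing s) (Lam l) (\<lambda>z. \<Phi> (Mu y # z)) (map Mu ys)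
    = (\<Sum>i\<in>set ys. f1 s (int l - int i) * (-1) ^ card {x \<in> set ys. i < x} * \<Phi> (Mu y # map Mu (remove1 i ys)))"
    using Cons by simp
  have "(\<Sum>i\<in>set ys. f1 s (int l - int i) * (-1) ^ card {x \<in> set (y # ys). i < x}
        * \<Phi> (map Mu (remove1 i (y # ys))))
      = (-1) ^ length ys * contract (pairing s) (Lam l) (\<lambda>z. \<Phi> (Mu y # z)) (map Mu ys)"
    unfolding IH
  proof (intro sum.cong refl)
    fix i assume i: "i \<in> set ys"
    then have "{x \<in> set (y # ys). i < x} = {x \<in> set ys. i < x}" "i \<noteq> y"
      using Cons.prems by auto
    then show "f1 s (int l - int i) * (-1) ^ card {x \<in> set (y # ys). i < x}
        * \<Phi> (map Mu (remove1 i (y # ys)))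
      = f1 s (int l - int i) * (-1) ^ card {x \<in> set ys. i < x} * \<Phi> (Mu y # map Mu (remove1 i ys))"
      by simp
  qed
  then show ?case using y by (simp add: distinct_card algebra_simps)
qed simp

text \<open>
  From here on, a strict partition \<open>\<mu>\<close> is the set \<open>S\<close> of its parts: adding and removing parts are then
  insertion and deletion.
\<close>

definition word_coeff :: "nat \<Rightarrow> nat set \<Rightarrow> nat list \<Rightarrow> rat" where
  "word_coeff s S ls = padded_pf s (map Mu (asc S) @ map Lam ls)"

text \<open>
  The expansion \<open>padded_pf_expand\<close> with all parts sorted into place.  Parts \<open>j\<close> that are already present
  give two equal rows and drop out.
\<close>

lemma word_coeff_Cons:
  assumes ls: "\<And>c. c \<in> set ls \<Longrightarrow> c < l \<and> c \<le> J" and S: "finite S"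
  shows "word_coeff s S (l # ls)
    = (\<Sum>i\<in>S. f1 s (int l - int i) * above_sgn i S * word_coeff s (S - {i}) ls)
      + f1 s (int l) * (-1) ^ card S * word_coeff s S ls
      + (\<Sum>j\<in>{1..J} - S. 2 * (-1) ^ j * f1 s (int l + int j) * above_sgn j S * word_coeff s (insert j S) ls)"
proof -
  have "(\<Sum>j=1..J. 2 * (-1) ^ j * f1 s (int l + int j) * padded_pf s (map Mu (asc S) @ Mu j # map Lam ls))
      = (\<Sum>j\<in>{1..J} - S. 2 * (-1) ^ j * f1 s (int l + int j) * above_sgn j S * word_coeff s (insert j S) ls)"
    using S by (intro sum.mono_neutral_cong_right)
      (auto simp: padded_pf_insert_0 padded_pf_insert word_coeff_def)
  moreover have "(-1) ^ length (asc S) * contract (pairing s) (Lam l) (\<lambda>z. padded_pf s (z @ map Lam ls)) (map Mu (asc S))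
      = (\<Sum>i\<in>S. f1 s (int l - int i) * above_sgn i S * word_coeff s (S - {i}) ls)"
    using S by (subst contract_sorted) (simp_all add: word_coeff_def above_sgn_def sorted_list_of_set_remove)
  ultimately show ?thesis
    unfolding word_coeff_def[of s S "l # ls"] using S
    by (subst padded_pf_expand[where J = J]) (simp_all add: ls word_coeff_def)
qed

lemma word_coeff_Nil:
  assumes "finite S"
  shows "word_coeff s S [] = (if S = {} then 1 else 0)"
proof (cases "asc S")
  case Nil
  then show ?thesis using assms by (simp add: word_coeff_def padded_pf_def)
next
  case (Cons x xs)
  then have "S \<noteq> {}" by auto
  then show ?thesis using Cons by (simp add: word_coeff_def padded_pf_def contract_Mu_Mu)
qed


section \<open>Straightening products of the operators\<close>

lemma Q_dot_1_Cons: "Q_dot_1 (m # ms) = Q_op (int m) (Q_dot_1 ms)"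
  by (simp add: Q_dot_1_def)

lemma Q_dot_1_Nil: "Q_dot_1 [] = 1"
  by (simp add: Q_dot_1_def)

lemma minus_one_power_mult: "(-1) ^ k * (F :: Gamma) = scal ((-1) ^ k) F"
  by (induction k) simp_all

definition Q_set :: "nat set \<Rightarrow> Gamma" where
  "Q_set S = Q_dot_1 (rev (asc S))"

lemma Q_op_insert:
  assumes "finite S" "j \<notin> S"
  shows "Q_op (int j) (Q_set S) = scal (above_sgn j S) (Q_set (insert j S))"
proof -
  have swap: "Q_dot_1 (ws @ x # y # vs) = - Q_dot_1 (ws @ y # x # vs)" if "x < y" for ws vs and x y :: nat
  proof (induction ws)
    case Nil
    show ?case
      using Q_op_anticommute[of "int x" "int y" "Q_dot_1 vs"] that
      by (simp add: Q_dot_1_Cons eq_neg_iff_add_eq_0)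
  next
    case (Cons w ws)
    then show ?case by (simp add: Q_dot_1_Cons module_hom.neg[OF linop_Q_op])
  qed
  have "Q_dot_1 (rev (asc S @ [j])) = (-1) ^ card {x \<in> S. j < x} * Q_dot_1 (rev (asc (insert j S)))"
  proof (rule asc_insert_sign)
    show "Q_dot_1 (rev (us @ y # x # vs)) = - Q_dot_1 (rev (us @ x # y # vs))" if "x < y" for us x y vs
      using swap[OF that, of "rev vs" "rev us"] by simp
  qed (use assms in auto)
  then show ?thesis
    by (simp add: Q_set_def above_sgn_def minus_one_power_mult Q_dot_1_Cons)
qed

lemma Q_op_remove:
  assumes "finite S" "j \<in> S"
  shows "Q_set S = scal (above_sgn j S) (Q_op (int j) (Q_set (S - {j})))"
  using Q_op_insert[of "S - {j}" j] assms by (simp add: insert_absorb above_sgn_self)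

lemma Q_op_member:
  assumes "finite S" "j \<in> S" "j > 0"
  shows "Q_op (int j) (Q_set S) = 0"
proof -
  have "Q_op (int j) (Q_op (int j) F) + Q_op (int j) (Q_op (int j) F) = 0" for F
    using Q_op_anticommute[of "int j" "int j" F] assms(3) by simp
  then have "scal 2 (Q_op (int j) (Q_op (int j) F)) = 0" for F
    by (simp add: scal.scale_left_distrib[of 1 1, simplified])
  then show ?thesis
    by (subst Q_op_remove[OF assms(1,2)]) (simp add: linop_scal[OF linop_Q_op])
qed

lemma Q_op_0_list:
  "(\<And>x. x \<in> set ms \<Longrightarrow> x > 0) \<Longrightarrow> Q_op 0 (Q_dot_1 ms) = scal ((-1) ^ length ms) (Q_dot_1 ms)"
proof (induction ms)
  case Nil
  then show ?case by (simp add: Q_dot_1_Nil Q_op_1 qfun_0)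
next
  case (Cons m ms)
  have "Q_op 0 (Q_op (int m) (Q_dot_1 ms)) = - Q_op (int m) (Q_op 0 (Q_dot_1 ms))"
    using Q_op_anticommute[of 0 "int m" "Q_dot_1 ms"] Cons.prems[of m]
    by (simp add: eq_neg_iff_add_eq_0)
  then show ?case using Cons by (simp add: Q_dot_1_Cons linop_scal[OF linop_Q_op])
qed

lemma Q_op_0:
  assumes "finite S" "0 \<notin> S"
  shows "Q_op 0 (Q_set S) = scal ((-1) ^ card S) (Q_set S)"
  unfolding Q_set_def using assms by (subst Q_op_0_list) (auto intro: gr0I)

text \<open>
  \<open>Q\<^bsub>-j\<^esub>\<close> anticommutes with all factors and kills 1.
\<close>

lemma Q_op_neg_list:
  "j > 0 \<Longrightarrow> j \<notin> set ms \<Longrightarrow> Q_op (- int j) (Q_dot_1 ms) = 0"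
proof (induction ms)
  case Nil
  then show ?case by (simp add: Q_dot_1_Nil Q_op_1 qfun_neg)
next
  case (Cons m ms)
  have "Q_op (- int j) (Q_op (int m) (Q_dot_1 ms)) = - Q_op (int m) (Q_op (- int j) (Q_dot_1 ms))"
    using Q_op_anticommute[of "- int j" "int m" "Q_dot_1 ms"] Cons.prems
    by (simp add: eq_neg_iff_add_eq_0)
  then show ?case using Cons by (simp add: Q_dot_1_Cons linop_zero[OF linop_Q_op])
qed

lemma Q_op_neg_notin:
  assumes "finite S" "j \<notin> S" "j > 0"
  shows "Q_op (- int j) (Q_set S) = 0"
  unfolding Q_set_def using assms by (intro Q_op_neg_list) auto

lemma Q_op_neg_nonzero:
  "Q_op (- int j) (Q_set S) \<noteq> 0 \<Longrightarrow> finite S \<Longrightarrow> j > 0 \<Longrightarrow> j \<in> S"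
  using Q_op_neg_notin by blast

lemma Q_op_neg_member:
  assumes "finite S" "j \<in> S" "j > 0"
  shows "Q_op (- int j) (Q_set S) = scal (2 * (-1) ^ j * above_sgn j S) (Q_set (S - {j}))"
proof -
  have "Q_op (- int j) (Q_op (int j) (Q_set (S - {j}))) = scal (2 * (-1) ^ j) (Q_set (S - {j}))"
    using Q_op_anticommute[of "- int j" "int j" "Q_set (S - {j})"] assms
    by (simp add: Q_op_neg_notin linop_zero[OF linop_Q_op] parity_sign_def)
  then show ?thesis
    by (subst Q_op_remove[OF assms(1,2)]) (simp add: linop_scal[OF linop_Q_op] mult_ac)
qed

definition index_sets :: "nat \<Rightarrow> int \<Rightarrow> nat set set" where
  "index_sets W m = {S. S \<subseteq> {1..W} \<and> int (\<Sum>S) = m}"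

lemma finite_index_sets [simp]: "finite (index_sets W m)"
  unfolding index_sets_def by (rule finite_subset[of _ "Pow {1..W}"]) auto

lemma index_setsD:
  assumes "S \<in> index_sets W m"
  shows "finite S" "0 \<notin> S" "S \<subseteq> {1..W}"
  using assms finite_subset[of S "{1..W}"] by (auto simp: index_sets_def)

lemma index_sets_bounds: "S \<in> index_sets W m \<Longrightarrow> i \<in> S \<Longrightarrow> Suc 0 \<le> i \<and> i \<le> W"
  by (auto simp: index_sets_def)

lemma index_sets_insert:
  assumes "S \<in> index_sets W (m - int i)" "i \<in> {1..W}" "i \<notin> S"
  shows "insert i S \<in> index_sets W m"
  using assms index_setsD(1)[OF assms(1)] by (simp add: index_sets_def)

lemma index_sets_remove:
  assumes "S \<in> index_sets W m" "i \<in> S"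
  shows "S - {i} \<in> index_sets W (m - int i)"
proof -
  have "sum int S = int i + sum int (S - {i})"
    by (rule sum.remove[OF index_setsD(1)[OF assms(1)] assms(2)])
  then show ?thesis using assms by (auto simp: index_sets_def)
qed

text \<open>
  Adding a part: the pairs \<open>(i, S)\<close> with \<open>i \<notin> S\<close> correspond to the pairs \<open>(insert i S, i)\<close>.
\<close>

lemma straighten_positive:
  "(\<Sum>i\<in>{1..W}. \<Sum>S\<in>index_sets W (n - int i). scal (g i * c S) (Q_op (int i) (Q_set S)))
    = (\<Sum>S\<in>index_sets W n. scal (\<Sum>i\<in>S. g i * above_sgn i S * c (S - {i})) (Q_set S))"
proof -
  have "(\<Sum>i\<in>{1..W}. \<Sum>S\<in>index_sets W (n - int i). scal (g i * c S) (Q_op (int i) (Q_set S)))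
      = (\<Sum>(i, S)\<in>(SIGMA i:{1..W}. index_sets W (n - int i)). scal (g i * c S) (Q_op (int i) (Q_set S)))"
    by (simp add: sum.Sigma)
  also have "\<dots> = (\<Sum>(i, S)\<in>(SIGMA i:{1..W}. {S \<in> index_sets W (n - int i). i \<notin> S}).
      scal (g i * c S * above_sgn i S) (Q_set (insert i S)))"
    by (rule sum.mono_neutral_cong_right)
      (auto simp: Q_op_member Q_op_insert index_setsD)
  also have "\<dots> = (\<Sum>(S, i)\<in>(SIGMA S:index_sets W n. S).
      scal (g i * above_sgn i S * c (S - {i})) (Q_set S))"
    by (rule sum.reindex_bij_witness[of _ "\<lambda>(S, i). (i, S - {i})" "\<lambda>(i, S). (insert i S, i)"])
      (auto simp: insert_absorb above_sgn_self mult_ac index_sets_insert index_sets_remove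
        dest: index_sets_bounds)
  also have "\<dots> = (\<Sum>S\<in>index_sets W n. \<Sum>i\<in>S. scal (g i * above_sgn i S * c (S - {i})) (Q_set S))"
    by (rule sum.Sigma[symmetric]) (auto dest: index_setsD)
  finally show ?thesis by (simp add: scal.scale_sum_left)
qed

text \<open>
  Removing a part: the pairs \<open>(j, S)\<close> with \<open>j \<in> S\<close> correspond to the pairs \<open>(S - {j}, j)\<close>.
\<close>

lemma straighten_negative:
  "(\<Sum>j\<in>{1..W}. \<Sum>S\<in>index_sets W (n + int j). scal (g j * c S) (Q_op (- int j) (Q_set S)))
    = (\<Sum>S\<in>index_sets W n. scal (\<Sum>j\<in>{1..W} - S. 2 * (-1) ^ j * g j * above_sgn j S * c (insert j S)) (Q_set S))"
proof -
  have "(\<Sum>j\<in>{1..W}. \<Sum>S\<in>index_sets W (n + int j). scal (g j * c S) (Q_op (- int j) (Q_set S)))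
      = (\<Sum>(j, S)\<in>(SIGMA j:{1..W}. index_sets W (n + int j)). scal (g j * c S) (Q_op (- int j) (Q_set S)))"
    by (simp add: sum.Sigma)
  also have "\<dots> = (\<Sum>(j, S)\<in>(SIGMA j:{1..W}. {S \<in> index_sets W (n + int j). j \<in> S}).
      scal (g j * c S * (2 * (-1) ^ j * above_sgn j S)) (Q_set (S - {j})))"
    by (rule sum.mono_neutral_cong_right)
      (auto simp: Q_op_neg_member index_setsD intro: Q_op_neg_nonzero index_setsD(1))
  also have "\<dots> = (\<Sum>(S, j)\<in>(SIGMA S:index_sets W n. {1..W} - S).
      scal (2 * (-1) ^ j * g j * above_sgn j S * c (insert j S)) (Q_set S))"
  proof (rule sum.reindex_bij_witness[of _ "\<lambda>(S, j). (j, insert j S)" "\<lambda>(j, S). (S - {j}, j)"])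
    show "(case a of (S, j) \<Rightarrow> (j, insert j S)) \<in> (SIGMA j:{1..W}. {S \<in> index_sets W (n + int j). j \<in> S})"
      if "a \<in> (SIGMA S:index_sets W n. {1..W} - S)" for a
      using that index_sets_insert[of _ W "n + int (snd a)" "snd a"] by auto
    show "(case a of (j, S) \<Rightarrow> (S - {j}, j)) \<in> (SIGMA S:index_sets W n. {1..W} - S)"
      if "a \<in> (SIGMA j:{1..W}. {S \<in> index_sets W (n + int j). j \<in> S})" for a
      using that index_sets_remove[of "snd a" W "n + int (fst a)" "fst a"] by auto
  qed (auto simp: insert_absorb above_sgn_self mult_ac)
  also have "\<dots> = (\<Sum>S\<in>index_sets W n. \<Sum>j\<in>{1..W} - S. scal (2 * (-1) ^ j * g j * above_sgn j S * c (insert j S)) (Q_set S))"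
    by (rule sum.Sigma[symmetric]) auto
  finally show ?thesis by (simp add: scal.scale_sum_left)
qed

text \<open>
  Collecting the coefficient of \<open>Q\<^sub>S\<close> after one more operator \<open>\<Sum>i. g\<^sub>i Q\<^sub>i\<close> has been applied.  The bound \<open>W\<close> on
  indices and parts only keeps the sums finite.
\<close>

lemma straighten:
  "(\<Sum>i\<in>{- int W..int W}. \<Sum>S\<in>index_sets W (n - i). scal (g i * c S) (Q_op i (Q_set S)))
    = (\<Sum>S\<in>index_sets W n. scal
        ((\<Sum>i\<in>S. g (int i) * above_sgn i S * c (S - {i})) + g 0 * (-1) ^ card S * c S
          + (\<Sum>j\<in>{1..W} - S. 2 * (-1) ^ j * g (- int j) * above_sgn j S * c (insert j S))) (Q_set S))"
proof -
  let ?h = "\<lambda>i. \<Sum>S\<in>index_sets W (n - i). scal (g i * c S) (Q_op i (Q_set S))"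
  have "{- int W..int W} = int ` {1..W} \<union> {0} \<union> (\<lambda>j. - int j) ` {1..W}"
  proof (intro equalityI subsetI)
    fix i assume "i \<in> {- int W..int W}"
    then have "i = 0 \<or> (i = int (nat i) \<and> nat i \<in> {1..W}) \<or> (i = - int (nat (- i)) \<and> nat (- i) \<in> {1..W})"
      by auto
    then show "i \<in> int ` {1..W} \<union> {0} \<union> (\<lambda>j. - int j) ` {1..W}"
      by blast
  qed auto
  then have "(\<Sum>i\<in>{- int W..int W}. ?h i)
      = (\<Sum>i\<in>int ` {1..W} \<union> {0}. ?h i) + (\<Sum>i\<in>(\<lambda>j. - int j) ` {1..W}. ?h i)"
    by (simp only:) (rule sum.union_disjoint; auto)
  also have "(\<Sum>i\<in>int ` {1..W} \<union> {0}. ?h i) = (\<Sum>i\<in>int ` {1..W}. ?h i) + ?h 0"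
    by (subst sum.union_disjoint) auto
  also have "(\<Sum>i\<in>int ` {1..W}. ?h i) = (\<Sum>i\<in>{1..W}. ?h (int i))"
    by (subst sum.reindex) auto
  also have "(\<Sum>i\<in>(\<lambda>j. - int j) ` {1..W}. ?h i) = (\<Sum>j\<in>{1..W}. ?h (- int j))"
    by (subst sum.reindex) (auto simp: inj_on_def)
  also have "(\<Sum>i\<in>{1..W}. ?h (int i))
      = (\<Sum>S\<in>index_sets W n. scal (\<Sum>i\<in>S. g (int i) * above_sgn i S * c (S - {i})) (Q_set S))"
    by (rule straighten_positive)
  also have "(\<Sum>j\<in>{1..W}. ?h (- int j))
      = (\<Sum>S\<in>index_sets W n. scal (\<Sum>j\<in>{1..W} - S. 2 * (-1) ^ j * g (- int j) * above_sgn j S * c (insert j S)) (Q_set S))"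
    using straighten_negative[where g = "\<lambda>j. g (- int j)"] by simp
  also have "?h 0 = (\<Sum>S\<in>index_sets W n. scal (g 0 * (-1) ^ card S * c S) (Q_set S))"
    by (simp add: Q_op_0 index_setsD mult_ac)
  finally show ?thesis by (simp add: scal.scale_left_distrib sum.distrib)
qed


section \<open>The action on strict partitions\<close>

lemma f1_mult: "s > 0 \<Longrightarrow> f1 s (int (s * a)) = ratio_coeff 1 a"
  by (simp add: f1_def ratio_coeff_def)

lemma strict_partition_Cons:
  "strict_partition (l # ls) \<longleftrightarrow> l > 0 \<and> strict_partition ls \<and> (\<forall>c\<in>set ls. c < l)"
  by (auto simp: strict_partition_def)

text \<open>
  Needed because \<open>T\<^sub>k\<close> removes at most the weight \<open>sk\<close> while the sum over all \<open>i\<close> in \<open>straighten\<close> also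
  contains terms in which more than that would be removed from the first part.
\<close>

lemma word_coeff_large:
  assumes "S \<in> index_sets W m" "m > int (sum_list ls)"
  shows "word_coeff s S ls = 0"
proof (rule ccontr)
  assume "word_coeff s S ls \<noteq> 0"
  then have "sum_list (asc S) \<le> sum_list ls"
    unfolding word_coeff_def by (rule padded_pf_support)
  moreover have "sum_list (asc S) = \<Sum>S"
    using index_setsD(1)[OF assms(1)]
    by (metis distinct_sorted_list_of_set map_idI set_sorted_list_of_set sum_list_distinct_conv_sum_set)
  moreover have "int (\<Sum>S) = m" using assms(1) by (simp add: index_sets_def)
  ultimately show False using assms(2) by linarith
qed

text \<open>
  Both sides satisfy the same recursion on the first part \<open>l\<close>.  Under \<open>i = l - sa\<close> the sum over \<open>a \<le> k\<close>
  from \<open>T_Q_op\<close> becomes a sum over all integers \<open>|i| \<le> W\<close>, because the other terms vanish: either \<open>f\<^bsub>l-i\<^esub> = 0\<close>, or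
  \<open>a > k\<close> and the coefficient is 0 by weight.
\<close>

lemma T_minus_Q_dot_1:
  assumes "odd s" "strict_partition ls" "sum_list ls + s * k \<le> W"
  shows "T_minus s k (Q_dot_1 ls)
    = (\<Sum>S\<in>index_sets W (int (sum_list ls) - int (s * k)). scal (word_coeff s S ls) (Q_set S))"
  using assms(2,3)
proof (induction ls arbitrary: k)
  case Nil
  have s: "s > 0" using assms(1) by (rule odd_pos)
  have "(\<Sum>S\<in>index_sets W (- int (s * k)). scal (word_coeff s S []) (Q_set S))
      = (\<Sum>S\<in>index_sets W (- int (s * k)). if S = {} then 1 else 0)"
    by (intro sum.cong refl)
      (auto simp: word_coeff_Nil index_setsD Q_set_def Q_dot_1_Nil)
  also have "\<dots> = (if {} \<in> index_sets W (- int (s * k)) then 1 else 0)"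
    by simp
  also have "\<dots> = (if k = 0 then 1 else 0)"
    using s by (auto simp: index_sets_def)
  finally show ?case by (simp add: Q_dot_1_Nil T_1)
next
  case (Cons l ls)
  have s: "s > 0" using assms(1) by (rule odd_pos)
  define n where "n = int (sum_list (l # ls)) - int (s * k)"
  let ?h = "\<lambda>i. \<Sum>S\<in>index_sets W (n - i). scal (f1 s (int l - i) * word_coeff s S ls) (Q_op i (Q_set S))"
  have "T_minus s k (Q_dot_1 (l # ls))
      = (\<Sum>a\<le>k. scal (ratio_coeff 1 a) (Q_op (int l - int (s * a)) (T_minus s (k - a) (Q_dot_1 ls))))"
    by (simp add: Q_dot_1_Cons T_Q_op[OF assms(1)])
  also have "\<dots> = (\<Sum>a\<le>k. ?h (int l - int (s * a)))"
  proof (intro sum.cong refl)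
    fix a assume "a \<in> {..k}"
    then have a: "a \<le> k" by simp
    have eq: "int (sum_list ls) - int (s * (k - a)) = n - (int l - int (s * a))"
      using a by (simp add: n_def of_nat_diff right_diff_distrib')
    have "s * (k - a) \<le> s * k" by simp
    then have "sum_list ls + s * (k - a) \<le> W"
      using Cons.prems(2) unfolding sum_list.Cons by linarith
    then have "T_minus s (k - a) (Q_dot_1 ls)
        = (\<Sum>S\<in>index_sets W (n - (int l - int (s * a))). scal (word_coeff s S ls) (Q_set S))"
      using Cons.IH[of "k - a"] Cons.prems(1) unfolding eq by (simp add: strict_partition_Cons)
    then show "scal (ratio_coeff 1 a) (Q_op (int l - int (s * a)) (T_minus s (k - a) (Q_dot_1 ls)))
        = ?h (int l - int (s * a))"
      using f1_mult[OF s, of a]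
      by (simp add: linop_sum[OF linop_Q_op] linop_scal[OF linop_Q_op] scal.scale_sum_right)
  qed
  also have "\<dots> = (\<Sum>i\<in>(\<lambda>a. int l - int (s * a)) ` {..k}. ?h i)"
    using s by (subst sum.reindex) (auto simp: inj_on_def)
  also have "\<dots> = (\<Sum>i\<in>{- int W..int W}. ?h i)"
  proof (rule sum.mono_neutral_left)
    show "(\<lambda>a. int l - int (s * a)) ` {..k} \<subseteq> {- int W..int W}"
    proof
      fix i assume "i \<in> (\<lambda>a. int l - int (s * a)) ` {..k}"
      then obtain a where a: "a \<le> k" "i = int l - int (s * a)" by auto
      have "s * a \<le> s * k" using a(1) by simp
      then have "s * a \<le> W" "l \<le> W"
        using Cons.prems(2) unfolding sum_list.Cons by linarith+
      then show "i \<in> {- int W..int W}" by (auto simp: a(2) simp del: of_nat_mult)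
    qed
    show "\<forall>i\<in>{- int W..int W} - (\<lambda>a. int l - int (s * a)) ` {..k}. ?h i = 0"
    proof
      fix i assume i: "i \<in> {- int W..int W} - (\<lambda>a. int l - int (s * a)) ` {..k}"
      show "?h i = 0"
      proof (intro sum.neutral ballI)
        fix S assume S: "S \<in> index_sets W (n - i)"
        have "word_coeff s S ls = 0" if f: "f1 s (int l - i) \<noteq> 0"
        proof -
          have "int s dvd int l - i" "int l - i \<ge> 0" using f by (auto simp: f1_def split: if_splits)
          then obtain b where b: "int l - i = int s * b" "b \<ge> 0"
            using s by (metis dvd_def of_nat_0_less_iff zero_le_mult_iff not_less)
          then obtain a where a: "int l - i = int (s * a)"
            by (metis nonneg_int_cases of_nat_mult)
          then have "i = int l - int (s * a)" by linarith
          then have "\<not> a \<le> k" using i by blast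
          then have "s * k < s * a" using s by simp
          then have "int (s * k) < int (s * a)" by (simp only: of_nat_less_iff)
          then have "n - i > int (sum_list ls)"
            using a unfolding n_def sum_list.Cons of_nat_add by linarith
          then show ?thesis by (rule word_coeff_large[OF S])
        qed
        then show "scal (f1 s (int l - i) * word_coeff s S ls) (Q_op i (Q_set S)) = 0" by auto
      qed
    qed
  qed simp
  also have "\<dots> = (\<Sum>S\<in>index_sets W n. scal (word_coeff s S (l # ls)) (Q_set S))"
    unfolding straighten
  proof (intro sum.cong refl arg_cong2[of _ _ _ _ scal])
    fix S assume S: "S \<in> index_sets W n"
    have "c < l \<and> c \<le> W" if "c \<in> set ls" for c
      using that Cons.prems by (auto simp: strict_partition_Cons)
    from word_coeff_Cons[where J = W, OF this index_setsD(1)[OF S]]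
    show "(\<Sum>i\<in>S. f1 s (int l - int i) * above_sgn i S * word_coeff s (S - {i}) ls)
        + f1 s (int l - 0) * (-1) ^ card S * word_coeff s S ls
        + (\<Sum>j\<in>{1..W} - S. 2 * (-1) ^ j * f1 s (int l - - int j) * above_sgn j S * word_coeff s (insert j S) ls)
      = word_coeff s S (l # ls)"
      by simp
  qed
  finally show ?case unfolding n_def .
qed

lemma asc_set_strict_partition:
  assumes "strict_partition mu"
  shows "asc (set mu) = rev mu"
proof -
  have "sorted_wrt (<) (rev mu)"
    using assms by (simp add: strict_partition_def sorted_wrt_rev)
  then show ?thesis
    by (metis set_rev sorted_list_of_set.idem_if_sorted_distinct strict_sorted_iff)
qed

lemma strict_partition_index_set:
  assumes "S \<in> index_sets W m"
  shows "strict_partition (rev (asc S))"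
  using index_setsD(1,2)[OF assms]
  by (auto simp: strict_partition_def sorted_wrt_rev intro: gr0I)

lemma sum_list_distinct: "distinct xs \<Longrightarrow> sum_list xs = \<Sum>(set xs)"
  using sum_list_distinct_conv_sum_set[of xs "\<lambda>x. x"] by simp

lemma distinct_strict_partition: "strict_partition mu \<Longrightarrow> distinct mu"
  by (metis asc_set_strict_partition distinct_rev distinct_sorted_list_of_set)

lemma word_coeff_support:
  assumes "S \<in> index_sets W m" "strict_partition lam" "word_coeff s S lam \<noteq> 0"
  shows "part_contained (rev (asc S)) lam"
  using assms padded_pf_support(2)[of s "asc S" lam] strict_partition_index_set
  by (intro part_contained_if_counts) (auto simp: word_coeff_def rev_filter[symmetric])

theorem theorem3p4:
  fixes s k n :: nat and lam :: "nat list"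
  assumes "odd s"
    and "k > 0"
    and "strict_partition lam"
    and "sum_list lam = n + s * k"
  shows "T_minus s k (Q_dot_1 lam) =
    (\<Sum>mu | strict_partition mu \<and> sum_list mu = n \<and> part_contained mu lam.
      scal (pfaffian (M_tilde s lam mu)) (Q_dot_1 mu))"
proof -
  \<comment> \<open>The weight of \<open>\<lambda>\<close> bounds the parts; the summand \<open>sk\<close> leaves room for the negative indices \<open>l - sa\<close>.\<close>
  define W where "W = sum_list lam + s * k"
  have "T_minus s k (Q_dot_1 lam) = (\<Sum>S\<in>index_sets W (int n). scal (word_coeff s S lam) (Q_set S))"
    using T_minus_Q_dot_1[OF assms(1,3), of k W] assms(4) by (simp add: W_def)
  also have "\<dots> = (\<Sum>S | S \<in> index_sets W (int n) \<and> part_contained (rev (asc S)) lam.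
      scal (word_coeff s S lam) (Q_set S))"
    using assms(3) by (intro sum.mono_neutral_right) (auto dest: word_coeff_support)
  also have "\<dots> = (\<Sum>mu | strict_partition mu \<and> sum_list mu = n \<and> part_contained mu lam.
      scal (pfaffian (M_tilde s lam mu)) (Q_dot_1 mu))"
  proof (rule sum.reindex_bij_witness[of _ set "\<lambda>S. rev (asc S)"])
    fix S assume S: "S \<in> {S \<in> index_sets W (int n). part_contained (rev (asc S)) lam}"
    then have fin: "finite S" by (auto dest: index_setsD)
    then show "set (rev (asc S)) = S" by simp
    have "sum_list (asc S) = \<Sum>S" using fin by (simp add: sum_list_distinct)
    then show "rev (asc S) \<in> {mu. strict_partition mu \<and> sum_list mu = n \<and> part_contained mu lam}"
      using S strict_partition_index_set[of S] by (auto simp: index_sets_def simp flip: of_nat_sum)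
    show "scal (pfaffian (M_tilde s lam (rev (asc S)))) (Q_dot_1 (rev (asc S)))
        = scal (word_coeff s S lam) (Q_set S)"
      by (simp add: pfaffian_M_tilde[OF assms(3)] word_coeff_def Q_set_def)
  next
    fix mu assume mu: "mu \<in> {mu. strict_partition mu \<and> sum_list mu = n \<and> part_contained mu lam}"
    then have asc: "asc (set mu) = rev mu" by (simp add: asc_set_strict_partition)
    then show "rev (asc (set mu)) = mu" by simp
    have "set mu \<subseteq> {1..W}"
      using mu member_le_sum_list[of _ mu] assms(4) by (fastforce simp: strict_partition_def W_def)
    moreover have "\<Sum>(set mu) = n"
      using mu sum_list_distinct[of mu] by (simp add: distinct_strict_partition)
    ultimately show "set mu \<in> {S \<in> index_sets W (int n). part_contained (rev (asc S)) lam}"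
      using mu asc by (simp add: index_sets_def del: of_nat_sum)
  qed
  finally show ?thesis .
qed

end
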